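(* Let $D_1\subset D_2$ be bounded convex domains in $H_1=\mathbb{R}^3$ with smooth boundaries $\Sigma_i=\partial D_i$, $i=1,2$. Let $v$ be a vector (oriented line segment) of length $\ell$ with respect to the Levi metric, thrown at random, i.e. moved by the group of motions $PSH(1)$ equipped with the kinematic density $dK$. Then the probability that $v$ intersects $D_1$, given that it intersects $D_2$, defined as the quotient of measures $$P(v\cap D_1\mid v\cap D_2):=\frac{\int_{v\cap D_1\neq\emptyset}dK}{\int_{v\cap D_2\neq\emptyset}dK},$$ equals $$\frac{2\pi\,V(D_1)+2\ell\cdot\text{p-Area}(\Sigma_1)}{2\pi\,V(D_2)+2\ell\cdot\text{p-Area}(\Sigma_2)},$$ where each integral is over the motions in $PSH(1)$ for which the moved segment meets the indicated domain, $V$ is Lebesgue volume, and $\text{p-Area}$ is the p-area.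
   Context: The 3D-Heisenberg group $H_1$ is $\mathbb{R}^3$ with coordinates $(x,y,t)$ and left translations $L_{(a,b,c)}(x,y,t)=(a+x,\,b+y,\,c+t+bx-ay)$. Put $\mathring e_1=\partial_x+y\,\partial_t$, $\mathring e_2=\partial_y-x\,\partial_t$, $T=\partial_t$. The contact plane field is $\xi=\mathrm{span}\{\mathring e_1,\mathring e_2\}=\ker\Theta$, $\Theta=dt+x\,dy-y\,dx$; $J$ on $\xi$ is given by $J\mathring e_1=\mathring e_2$, $J\mathring e_2=-\mathring e_1$. The Levi metric is the inner product on $\xi$ for which $\mathring e_1,\mathring e_2$ are orthonormal ($dx^2+dy^2$ restricted to $\xi$). Convexity is meant in $\mathbb{R}^3$. Length: the velocity of a curve $\gamma$ decomposes as $\gamma'=\gamma'_\xi+\gamma'_T$ with $\gamma'_\xi\in\xi$ and $\gamma'_T\in\mathbb{R}T$; the length of $\gamma$ with respect to the Levi metric is $\int|\gamma'_\xi|\,ds$. Motions: $PSH(1)$ is the group of diffeomorphisms of $H_1$ preserving $J$ (on $\xi$) and $\Theta$. Its elements are the maps $L_Q\circ R_\phi$, where $Q=(a,b,c)\in\mathbb{R}^3$ and $R_\phi$ is the rotation by angle $\phi\in[0,2\pi)$ in the $(x,y)$-plane (fixing $t$). The kinematic density is $dK=da\wedge db\wedge dc\wedge d\phi$, taken in absolute value; here $Q$ is the position of the moved frame $(Q;e_1(Q),e_2(Q),T)$ and $\phi$ is the angle from $\mathring e_1(Q)$ to $e_1(Q)$ in $\xi_Q$. p-Area: a point $q$ of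 a smooth surface $\Sigma$ is singular if $\xi_q=T_q\Sigma$ and regular otherwise. At regular points let $e_1\in\xi\cap T\Sigma$ be a unit vector for the Levi metric (unique up to sign), $e_2=Je_1$, and let $(\omega^1,\omega^2,\Theta)$ be the coframe dual to $(e_1,e_2,T)$. Then $\text{p-Area}(\Sigma)=\int_\Sigma\Theta\wedge\omega^1$, where the form is extended by $0$ to singular points and signs are chosen so that the integrand is a nonnegative area density.
   Formalization: The oriented line segment v is assumed horizontal (its velocity lies in the contact plane at every point); for non-horizontal segments the formula fails, e.g. for a vertical segment, which has Levi length 0, and concentric balls of radii 1 and 2. *)

theory Defs
  imports "HOL-Analysis.Analysis"
begin

section \<open>Smooth maps and embedded surfaces\<close>

text \<open>Differentiability of order \<open>k\<close> on an open set, by iterating directional derivatives.\<close>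

primrec times_differentiable_on ::
    "nat \<Rightarrow> ('a::euclidean_space \<Rightarrow> 'b::euclidean_space) \<Rightarrow> 'a set \<Rightarrow> bool" where
  "times_differentiable_on 0 f S \<longleftrightarrow> continuous_on S f"
| "times_differentiable_on (Suc k) f S \<longleftrightarrow>
     (\<forall>x\<in>S. f differentiable (at x)) \<and>
     (\<forall>v. times_differentiable_on k (\<lambda>x. frechet_derivative f (at x) v) S)"

definition smooth_on :: "'a::euclidean_space set \<Rightarrow> ('a \<Rightarrow> 'b::euclidean_space) \<Rightarrow> bool" where
  "smooth_on S f \<longleftrightarrow> (\<forall>k. times_differentiable_on k f S)"

definition diffeomorphism :: "('a::euclidean_space \<Rightarrow> 'a) \<Rightarrow> bool" where
  "diffeomorphism F \<longleftrightarrow> bij F \<and> smooth_on UNIV F \<and> smooth_on UNIV (inv F)"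

definition surface_chart :: "(real^3) set \<Rightarrow> (real^2) set \<Rightarrow> (real^2 \<Rightarrow> real^3) \<Rightarrow> bool" where
  "surface_chart S U X \<longleftrightarrow>
     open U \<and> smooth_on U X \<and> (\<forall>u\<in>U. inj (frechet_derivative X (at u))) \<and>
     openin (top_of_set S) (X ` U) \<and> (\<exists>g. homeomorphism U (X ` U) X g)"

definition smooth_surface :: "(real^3) set \<Rightarrow> bool" where
  "smooth_surface S \<longleftrightarrow> (\<forall>q\<in>S. \<exists>U X. surface_chart S U X \<and> q \<in> X ` U)"


section \<open>The Heisenberg group\<close>

text \<open>The coordinates \<open>(x, y, t)\<close> of a point \<open>p\<close> are \<open>p$1\<close>, \<open>p$2\<close>, \<open>p$3\<close>; tangent vectors
  at every point are given by their components with respect to the coordinate vector fields.\<close>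

definition frame1 :: "real^3 \<Rightarrow> real^3" where
  "frame1 p = vector [1, 0, p$2]"

definition frame2 :: "real^3 \<Rightarrow> real^3" where
  "frame2 p = vector [0, 1, - (p$1)]"

definition frameT :: "real^3" where
  "frameT = vector [0, 0, 1]"

definition contact_form :: "real^3 \<Rightarrow> real^3 \<Rightarrow> real" where
  "contact_form p v = v$3 + p$1 * v$2 - p$2 * v$1"

definition contact_plane :: "real^3 \<Rightarrow> (real^3) set" where
  "contact_plane p = span {frame1 p, frame2 p}"

text \<open>A vector of \<^term>\<open>contact_plane p\<close> with first components \<open>a\<close>, \<open>b\<close> is
  \<^term>\<open>a *\<^sub>R frame1 p + b *\<^sub>R frame2 p\<close>. The next two definitions are meant for vectors of
  the contact plane only.\<close>

definition J :: "real^3 \<Rightarrow> real^3 \<Rightarrow> real^3" where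
  "J p v = v$1 *\<^sub>R frame2 p - v$2 *\<^sub>R frame1 p"

definition levi_norm :: "real^3 \<Rightarrow> real" where
  "levi_norm v = sqrt ((v$1)\<^sup>2 + (v$2)\<^sup>2)"

definition contact_part :: "real^3 \<Rightarrow> real^3 \<Rightarrow> real^3" where
  "contact_part p v = v - contact_form p v *\<^sub>R frameT"

definition levi_length :: "(real \<Rightarrow> real^3) \<Rightarrow> real" where
  "levi_length \<gamma> =
     integral {0..1} (\<lambda>s. levi_norm (contact_part (\<gamma> s) (vector_derivative \<gamma> (at s))))"

definition horizontal :: "(real \<Rightarrow> real^3) \<Rightarrow> bool" where
  "horizontal \<gamma> \<longleftrightarrow> (\<forall>s\<in>{0..1}. vector_derivative \<gamma> (at s) \<in> contact_plane (\<gamma> s))"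


section \<open>Motions and the kinematic measure\<close>

definition PSH1 :: "(real^3 \<Rightarrow> real^3) set" where
  "PSH1 = {F. diffeomorphism F \<and>
     (\<forall>p v. contact_form (F p) (frechet_derivative F (at p) v) = contact_form p v) \<and>
     (\<forall>p. \<forall>v\<in>contact_plane p.
        frechet_derivative F (at p) (J p v) = J (F p) (frechet_derivative F (at p) v))}"

text \<open>A motion \<open>F\<close> carries the standard frame at the origin to the frame \<open>(Q; e\<^sub>1(Q), e\<^sub>2(Q), T)\<close>
  with \<open>Q = F 0\<close> and \<open>e\<^sub>1(Q)\<close> the image of \<^term>\<open>frame1 0\<close>; its angle is the oriented angle
  from \<^term>\<open>frame1 Q\<close> to \<open>e\<^sub>1(Q)\<close>. Left translation by \<open>Q\<close> after rotation by \<open>\<phi>\<close> has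
  coordinates \<open>(Q, \<phi>)\<close>.\<close>

definition motion_angle :: "(real^3 \<Rightarrow> real^3) \<Rightarrow> real" where
  "motion_angle F = (THE \<phi>. 0 \<le> \<phi> \<and> \<phi> < 2 * pi \<and>
     frechet_derivative F (at 0) (frame1 0) =
       cos \<phi> *\<^sub>R frame1 (F 0) + sin \<phi> *\<^sub>R frame2 (F 0))"

text \<open>The integral over a set of motions of the density \<open>dK = da \<and> db \<and> dc \<and> d\<phi>\<close>.\<close>

definition kinematic_measure :: "(real^3 \<Rightarrow> real^3) set \<Rightarrow> real" where
  "kinematic_measure A = measure lborel ((\<lambda>F. (F 0, motion_angle F)) ` A)"


section \<open>The p-area\<close>

text \<open>The form \<open>\<omega>\<^sup>1\<close> of the coframe dual to \<open>(e, J e, T)\<close> at \<open>q\<close>.\<close>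

definition coframe1 :: "real^3 \<Rightarrow> real^3 \<Rightarrow> real^3 \<Rightarrow> real" where
  "coframe1 q e w = (THE a. \<exists>b c. w = a *\<^sub>R e + b *\<^sub>R J q e + c *\<^sub>R frameT)"

text \<open>The value of \<open>\<bar>\<Theta> \<and> \<omega>\<^sup>1\<bar>\<close> on the basis \<open>u, v\<close> of the tangent plane at \<open>q\<close> of a surface, and 0 at
  singular points. The vector \<open>e\<close> is unique up to sign, which the absolute value removes.\<close>

definition p_area_density :: "real^3 \<Rightarrow> real^3 \<Rightarrow> real^3 \<Rightarrow> real" where
  "p_area_density q u v =
     (if contact_plane q = span {u, v} then 0
      else let e = (SOME e. e \<in> contact_plane q \<inter> span {u, v} \<and> levi_norm e = 1)
           in \<bar>contact_form q u * coframe1 q e v - contact_form q v * coframe1 q e u\<bar>)"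

text \<open>The surface is cut into countably many disjoint Borel pieces \<open>X i ` B i\<close>, each lying in
  one chart, and the pullbacks of the density are integrated over the \<open>B i\<close>. By the change of
  variables formula the value does not depend on the decomposition.\<close>

definition chart_decomposition ::
    "(real^3) set \<Rightarrow> (nat \<Rightarrow> real^2 \<Rightarrow> real^3) \<Rightarrow> (nat \<Rightarrow> (real^2) set) \<Rightarrow> bool" where
  "chart_decomposition S X B \<longleftrightarrow>
     (\<forall>i. B i \<in> sets borel \<and> (\<exists>U. surface_chart S U (X i) \<and> B i \<subseteq> U)) \<and>
     disjoint_family (\<lambda>i. X i ` B i) \<and> (\<Union>i. X i ` B i) = S"

definition p_area :: "(real^3) set \<Rightarrow> real" where
  "p_area S = enn2real (THE A. \<exists>X B. chart_decomposition S X B \<and>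
     A = (\<Sum>i. \<integral>\<^sup>+ u \<in> B i. ennreal (p_area_density (X i u)
            (frechet_derivative (X i) (at u) (axis 1 1))
            (frechet_derivative (X i) (at u) (axis 2 1))) \<partial>lborel))"

end

theory Submission
  imports Defs
begin

text \<open>
  For a body \<open>D\<close> the set of motions that make the segment meet \<open>D\<close> has kinematic measure
  \<open>2\<pi> V(D) + 2 \<ell> p-Area(\<partial>D)\<close>, for every horizontal segment of length \<open>\<ell>\<close>; the theorem divides two
  such values (\<open>kinematic_measure_segment\<close>).

  A map that preserves \<open>\<Theta>\<close> and \<open>J\<close> is a left translation after a rotation: preserving
  \<open>d\<Theta> = 2 dx \<and> dy\<close> forces the first two components to be independent of \<open>t\<close>, and with \<open>J\<close> they
  form a holomorphic function of \<open>x + iy\<close> whose derivative has modulus 1, hence is constant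
  (\<open>PSH1_imp_motion\<close>). So \<open>(Q, \<phi>)\<close> are coordinates on the group. For fixed \<open>\<phi>\<close>, moving the segment
  \<open>p, q\<close> gives \<open>{P + s U(P). 0 \<le> s \<le> \<ell>}\<close>, where \<open>P\<close> is the moved \<open>p\<close> and
  \<open>U = cos \<theta> e\<^sub>1 + sin \<theta> e\<^sub>2\<close> with \<open>\<theta> - \<phi>\<close> constant. The map \<open>Q \<mapsto> P\<close> preserves volume, so the
  volume of the set of the points \<open>P\<close> whose segment meets \<open>D\<close> is needed.

  The integral curves of \<open>U\<close> are straight lines. They are the fibres of a map to the plane, called
  the shadow here, and position along the line together with the shadow is a volume-preserving
  coordinate system. On each line that meets the convex set \<open>D\<close> an open interval is prolonged by
  \<open>\<ell>\<close>, so the volume is \<open>V(D) + \<ell> area(shadow of D)\<close> (\<open>emeasure_swept\<close>).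

  A line that meets \<open>D\<close> enters it through exactly one boundary point and leaves it through
  exactly one. Hence the shadow of \<open>D\<close> is covered once by the entrance points and once by the exit points, while at all
  other boundary points a supporting plane contains the line and the Jacobian of the shadow map on
  the surface vanishes. By the change of variables formula the integral over \<open>\<partial>D\<close> of the absolute
  Jacobian is twice the area of the shadow (\<open>nn_integral_chart_jacobian\<close>).

  At a point of the surface with tangent basis \<open>u, v\<close> this Jacobian is \<open>det (u, v, U)\<close>, of the form
  \<open>a cos \<theta> + b sin \<theta>\<close>, whose absolute value has integral \<open>4 sqrt (a\<^sup>2 + b\<^sup>2)\<close> over a period;
  and \<open>sqrt (a\<^sup>2 + b\<^sup>2)\<close> is the p-area density (\<open>p_area_density_eq\<close>). So the shadow area integrated
  over all directions is \<open>2 p-Area(\<partial>D)\<close>. This integral does not refer to charts, which also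
  shows that the p-area does not depend on the decomposition of the surface
  (\<open>p_area_eq_shadow_area\<close>).
\<close>


section \<open>Smooth maps and the symmetry of second derivatives\<close>

lemma smooth_on_has_derivative:
  assumes "smooth_on S f" "x \<in> S"
  shows "(f has_derivative frechet_derivative f (at x)) (at x)"
proof -
  have "times_differentiable_on (Suc 0) f S"
    using assms(1) by (simp only: smooth_on_def)
  then show ?thesis
    using assms(2) frechet_derivative_works by auto
qed

lemma smooth_on_frechet_derivative:
  assumes "smooth_on S f"
  shows "smooth_on S (\<lambda>x. frechet_derivative f (at x) v)"
  unfolding smooth_on_def
proof
  fix k
  have "times_differentiable_on (Suc k) f S"
    using assms by (simp only: smooth_on_def)
  then show "times_differentiable_on k (\<lambda>x. frechet_derivative f (at x) v) S"
    by simp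
qed

lemma smooth_on_continuous_on:
  assumes "smooth_on S f"
  shows "continuous_on S f"
proof -
  have "times_differentiable_on 0 f S"
    using assms by (simp only: smooth_on_def)
  then show ?thesis
    by simp
qed

lemma smooth_on_affine:
  fixes L :: "'a::euclidean_space \<Rightarrow> 'b::euclidean_space"
  assumes "linear L"
  shows "smooth_on S (\<lambda>x. c + L x)"
proof -
  have const: "times_differentiable_on k (\<lambda>x. d) S" for k and d :: 'b
    by (induction k arbitrary: d) auto
  have der: "((\<lambda>x. c + L x) has_derivative L) (at x)" for x
    using assms by (auto intro!: derivative_eq_intros linear_imp_has_derivative)
  have "times_differentiable_on k (\<lambda>x. c + L x) S" for k
  proof (cases k)
    case 0
    then show ?thesis
      using assms by (simp add: continuous_on_add linear_continuous_on linear_linear)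
  next
    case (Suc m)
    have "frechet_derivative (\<lambda>x. c + L x) (at x) = L" for x
      using der frechet_derivative_at by metis
    then show ?thesis
      using der const Suc by (auto simp: differentiable_def)
  qed
  then show ?thesis
    by (simp add: smooth_on_def)
qed

text \<open>The second difference is a difference of the increments of \<open>f\<close> along \<open>u\<close>; the mean value
  theorem applied first along \<open>u\<close> and then along \<open>v\<close> turns it into one value of the second
  derivative. It is symmetric in \<open>u\<close> and \<open>v\<close>, which is why it yields the next lemma.\<close>
lemma second_difference_mean_value:
  fixes f :: "'a::real_normed_vector \<Rightarrow> real"
  assumes D: "\<And>x. (f has_derivative D x) (at x)"
    and D2: "\<And>x. ((\<lambda>x. D x u) has_derivative E x) (at x)"
    and "0 < h"
  shows "\<exists>\<xi>\<in>{0<..<h}. \<exists>\<eta>\<in>{0<..<h}.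
    f (p + h *\<^sub>R u + h *\<^sub>R v) - f (p + h *\<^sub>R u) - f (p + h *\<^sub>R v) + f p =
      h * h * E (p + \<xi> *\<^sub>R u + \<eta> *\<^sub>R v) v"
proof -
  define G where "G s = f (p + h *\<^sub>R v + s *\<^sub>R u) - f (p + s *\<^sub>R u)" for s
  have lin: "linear (D x)" "linear (E x)" for x
    using D D2 has_derivative_linear by blast+
  have "(G has_real_derivative D (p + h *\<^sub>R v + s *\<^sub>R u) u - D (p + s *\<^sub>R u) u) (at s)" for s
    unfolding G_def has_field_derivative_def
    by (rule derivative_eq_intros has_derivative_compose[OF _ D] refl)+
      (auto simp: fun_eq_iff linear_cmul[OF lin(1)] algebra_simps)
  then obtain \<xi> where \<xi>: "0 < \<xi>" "\<xi> < h"
      "G h - G 0 = (h - 0) * (D (p + h *\<^sub>R v + \<xi> *\<^sub>R u) u - D (p + \<xi> *\<^sub>R u) u)"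
    using MVT2[OF \<open>0 < h\<close>, of G
        "\<lambda>s. D (p + h *\<^sub>R v + s *\<^sub>R u) u - D (p + s *\<^sub>R u) u"] by blast
  define K where "K r = D (p + \<xi> *\<^sub>R u + r *\<^sub>R v) u" for r
  have "(K has_real_derivative E (p + \<xi> *\<^sub>R u + r *\<^sub>R v) v) (at r)" for r
  proof -
    have "((\<lambda>r. p + \<xi> *\<^sub>R u + r *\<^sub>R v) has_derivative (\<lambda>r. r *\<^sub>R v)) (at r)"
      by (auto intro!: derivative_eq_intros)
    from has_derivative_compose[OF this D2] show ?thesis
      unfolding K_def has_field_derivative_def
      by (rule has_derivative_eq_rhs) (simp add: fun_eq_iff linear_cmul[OF lin(2)])
  qed
  then obtain \<eta> where \<eta>: "0 < \<eta>" "\<eta> < h"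
      "K h - K 0 = (h - 0) * E (p + \<xi> *\<^sub>R u + \<eta> *\<^sub>R v) v"
    using MVT2[OF \<open>0 < h\<close>, of K "\<lambda>r. E (p + \<xi> *\<^sub>R u + r *\<^sub>R v) v"] by blast
  have "G h - G 0 = h * (K h - K 0)"
    using \<xi>(3) by (simp add: K_def algebra_simps)
  then show ?thesis
    using \<xi>(1,2) \<eta> by (intro bexI[of _ \<xi>] bexI[of _ \<eta>]) (auto simp: G_def algebra_simps)
qed

text \<open>The same second difference is \<open>h\<^sup>2\<close> times a value of either mixed derivative at a point close
  to \<open>p\<close>; continuity at \<open>p\<close> then identifies the two limits as \<open>h\<close> tends to 0.\<close>
lemma second_derivative_symmetric:
  fixes f :: "'a::real_normed_vector \<Rightarrow> real"
  assumes D: "\<And>x. (f has_derivative D x) (at x)"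
    and D2: "\<And>u x. ((\<lambda>x. D x u) has_derivative E u x) (at x)"
    and cont: "\<And>u v. isCont (\<lambda>x. E u x v) p"
  shows "E u p v = E v p u"
proof (rule ccontr)
  define e where "e = \<bar>E u p v - E v p u\<bar> / 2"
  assume "E u p v \<noteq> E v p u"
  then have "e > 0"
    by (simp add: e_def)
  then obtain d1 d2 where d: "d1 > 0" "\<And>x. dist x p < d1 \<Longrightarrow> dist (E u x v) (E u p v) < e"
      "d2 > 0" "\<And>x. dist x p < d2 \<Longrightarrow> dist (E v x u) (E v p u) < e"
    using cont[of u v] cont[of v u] unfolding continuous_at_eps_delta by metis
  \<comment> \<open>so small that all points in the second difference are within \<open>min d1 d2\<close> of \<open>p\<close>\<close>
  define h where "h = min d1 d2 / (norm u + norm v + 1)"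
  have pos: "norm u + norm v + 1 > 0"
    by (simp add: add_nonneg_pos)
  have h: "h > 0" "h * (norm u + norm v + 1) = min d1 d2"
    using d(1,3) pos by (simp_all add: h_def)
  have near: "dist (p + \<xi> *\<^sub>R a + \<eta> *\<^sub>R b) p < min d1 d2"
    if "\<xi> \<in> {0<..<h}" "\<eta> \<in> {0<..<h}" "norm a + norm b = norm u + norm v" for \<xi> \<eta> a b
  proof -
    have "dist (p + \<xi> *\<^sub>R a + \<eta> *\<^sub>R b) p \<le> \<xi> * norm a + \<eta> * norm b"
      using norm_triangle_ineq[of "\<xi> *\<^sub>R a" "\<eta> *\<^sub>R b"] that by (simp add: dist_norm add.assoc)
    also have "\<dots> \<le> h * norm a + h * norm b"
      using that by (intro add_mono mult_right_mono) auto
    also have "\<dots> < h * (norm a + norm b + 1)"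
      using h by (simp add: algebra_simps)
    finally show ?thesis
      using h that by simp
  qed
  obtain \<xi> \<eta> where 1: "\<xi> \<in> {0<..<h}" "\<eta> \<in> {0<..<h}"
      "f (p + h *\<^sub>R u + h *\<^sub>R v) - f (p + h *\<^sub>R u) - f (p + h *\<^sub>R v) + f p =
        h * h * E u (p + \<xi> *\<^sub>R u + \<eta> *\<^sub>R v) v"
    using second_difference_mean_value[OF D D2 \<open>h > 0\<close>] by blast
  obtain \<xi>' \<eta>' where 2: "\<xi>' \<in> {0<..<h}" "\<eta>' \<in> {0<..<h}"
      "f (p + h *\<^sub>R v + h *\<^sub>R u) - f (p + h *\<^sub>R v) - f (p + h *\<^sub>R u) + f p =
        h * h * E v (p + \<xi>' *\<^sub>R v + \<eta>' *\<^sub>R u) u"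
    using second_difference_mean_value[OF D D2 \<open>h > 0\<close>] by blast
  have comm: "p + h *\<^sub>R v + h *\<^sub>R u = p + h *\<^sub>R u + h *\<^sub>R v"
    by simp
  have "h * h * E u (p + \<xi> *\<^sub>R u + \<eta> *\<^sub>R v) v = h * h * E v (p + \<xi>' *\<^sub>R v + \<eta>' *\<^sub>R u) u"
    using 1(3) 2(3) unfolding comm by linarith
  then have "E u (p + \<xi> *\<^sub>R u + \<eta> *\<^sub>R v) v = E v (p + \<xi>' *\<^sub>R v + \<eta>' *\<^sub>R u) u"
    using h(1) by simp
  moreover have "dist (E u (p + \<xi> *\<^sub>R u + \<eta> *\<^sub>R v) v) (E u p v) < e"
    using near[OF 1(1,2)] by (intro d) simp
  moreover have "dist (E v (p + \<xi>' *\<^sub>R v + \<eta>' *\<^sub>R u) u) (E v p u) < e"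
    using near[OF 2(1,2)] by (intro d) simp
  ultimately show False
    unfolding dist_real_def e_def by (smt (verit) field_sum_of_halves)
qed

lemma smooth_on_second_derivative_symmetric:
  fixes f :: "'a::euclidean_space \<Rightarrow> real^'n"
  assumes "smooth_on UNIV f"
  shows "frechet_derivative (\<lambda>x. frechet_derivative f (at x) u) (at p) v =
         frechet_derivative (\<lambda>x. frechet_derivative f (at x) v) (at p) u"
  unfolding vec_eq_iff
proof
  fix i
  let ?E = "\<lambda>u x v. frechet_derivative (\<lambda>x. frechet_derivative f (at x) u) (at x) v $ i"
  have "?E u p v = ?E v p u"
  proof (rule second_derivative_symmetric[where E = ?E])
    show "((\<lambda>x. f x $ i) has_derivative (\<lambda>v. frechet_derivative f (at x) v $ i)) (at x)" for x
      using smooth_on_has_derivative[OF assms]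
      by (intro bounded_linear.has_derivative[OF bounded_linear_vec_nth]) auto
    show "((\<lambda>x. frechet_derivative f (at x) u $ i) has_derivative ?E u x) (at x)" for u x
      using smooth_on_has_derivative[OF smooth_on_frechet_derivative[OF assms]]
      by (intro bounded_linear.has_derivative[OF bounded_linear_vec_nth]) auto
    show "isCont (\<lambda>x. ?E u x v) p" for u v
      using smooth_on_continuous_on[OF smooth_on_frechet_derivative[OF
          smooth_on_frechet_derivative[OF assms]]]
      by (intro continuous_intros) (auto simp: continuous_on_eq_continuous_at)
  qed
  then show "?E u p v = ?E v p u" .
qed


section \<open>The group of motions\<close>

text \<open>The derivative of the rotation by \<open>\<phi>\<close> followed by the left translation by \<open>Q\<close>. The composite map
  is affine, so the derivative is the same at every point.\<close>

definition motion_linear :: "real^3 \<Rightarrow> real \<Rightarrow> real^3 \<Rightarrow> real^3" where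
  "motion_linear Q \<phi> v = vector
     [cos \<phi> * v$1 - sin \<phi> * v$2, sin \<phi> * v$1 + cos \<phi> * v$2,
      v$3 + Q$2 * (cos \<phi> * v$1 - sin \<phi> * v$2) - Q$1 * (sin \<phi> * v$1 + cos \<phi> * v$2)]"

definition motion :: "real^3 \<Rightarrow> real \<Rightarrow> real^3 \<Rightarrow> real^3" where
  "motion Q \<phi> p = Q + motion_linear Q \<phi> p"

lemma linear_motion_linear: "linear (motion_linear Q \<phi>)"
  by (rule linearI) (simp_all add: motion_linear_def vec_eq_iff forall_3 algebra_simps)

lemma motion_at_0 [simp]: "motion Q \<phi> 0 = Q"
  using linear_0[OF linear_motion_linear] by (simp add: motion_def)

lemma motion_has_derivative: "(motion Q \<phi> has_derivative motion_linear Q \<phi>) (at p)"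
  unfolding motion_def
  by (auto intro!: derivative_eq_intros linear_imp_has_derivative linear_motion_linear)

lemma frechet_derivative_motion [simp]:
  "frechet_derivative (motion Q \<phi>) (at p) = motion_linear Q \<phi>"
  using motion_has_derivative frechet_derivative_at by metis

lemma sin_cos_cancel:
  fixes \<phi> a b :: real
  shows "cos \<phi> * (cos \<phi> * a - sin \<phi> * b) + sin \<phi> * (sin \<phi> * a + cos \<phi> * b) = a"
    and "cos \<phi> * (sin \<phi> * a + cos \<phi> * b) - sin \<phi> * (cos \<phi> * a - sin \<phi> * b) = b"
  using sin_cos_squared_add[of \<phi>] by algebra+

lemma diffeomorphism_motion: "diffeomorphism (motion Q \<phi>)"
proof -
  define L where "L w = (vector [cos \<phi> * w$1 + sin \<phi> * w$2, cos \<phi> * w$2 - sin \<phi> * w$1,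
      w$3 - Q$2 * w$1 + Q$1 * w$2] :: real^3)" for w :: "real^3"
  have lin: "linear L"
    by (rule linearI) (simp_all add: L_def vec_eq_iff forall_3 algebra_simps)
  have 1: "L (motion_linear Q \<phi> v) = v" for v
    by (simp add: L_def motion_linear_def vec_eq_iff forall_3 sin_cos_cancel)
  have 2: "motion_linear Q \<phi> (L w) = w" for w
    using sin_cos_cancel[of "-\<phi>" "w$1" "w$2"]
    by (simp add: L_def motion_linear_def vec_eq_iff forall_3 algebra_simps)
  have "L (motion Q \<phi> p - Q) = p" "motion Q \<phi> (L (y - Q)) = y" for p y
    by (simp_all add: 1 2 motion_def)
  then have bij: "bij (motion Q \<phi>)" and "inv (motion Q \<phi>) = (\<lambda>y. L (y - Q))"
    by (auto intro!: o_bij[of "\<lambda>y. L (y - Q)"] inv_equality)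
  then have "inv (motion Q \<phi>) = (\<lambda>y. - L Q + L y)"
    by (simp add: fun_eq_iff linear_diff[OF lin])
  then show ?thesis
    using bij smooth_on_affine[OF lin, of UNIV "- L Q"]
      smooth_on_affine[OF linear_motion_linear, of UNIV Q Q \<phi>]
    by (simp only: diffeomorphism_def motion_def[abs_def] simp_thms)
qed

lemma motion_in_PSH1: "motion Q \<phi> \<in> PSH1"
proof -
  have "contact_form (motion Q \<phi> p) (motion_linear Q \<phi> v) = contact_form p v" for p v
    by (simp add: contact_form_def motion_def motion_linear_def,
        insert sin_cos_squared_add[of \<phi>], algebra)
  moreover have "motion_linear Q \<phi> (J p v) = J (motion Q \<phi> p) (motion_linear Q \<phi> v)" for p v
    by (simp add: J_def frame1_def frame2_def motion_def motion_linear_def vec_eq_iff forall_3,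
        insert sin_cos_squared_add[of \<phi>], algebra)
  ultimately show ?thesis
    by (simp add: PSH1_def diffeomorphism_motion)
qed

lemma vec3_expand: "v = v$1 *\<^sub>R axis 1 1 + v$2 *\<^sub>R axis 2 1 + v$3 *\<^sub>R axis 3 1" for v :: "real^3"
  by (simp add: vec_eq_iff forall_3 axis_def)

lemma has_derivative_vec_nth:
  assumes "(f has_derivative f') F"
  shows "((\<lambda>x. f x $ i) has_derivative (\<lambda>v. f' v $ i)) F"
  by (rule bounded_linear.has_derivative[OF bounded_linear_vec_nth assms])

lemma constant_if_zero_derivative:
  fixes f :: "'a::real_normed_vector \<Rightarrow> 'b::real_normed_vector"
  assumes "\<And>x. (f has_derivative (\<lambda>_. 0)) (at x)"
  shows "f x = f y"
  using has_derivative_zero_unique[of UNIV f y x] assms by simp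

text \<open>Differentiating the equation \<open>F\<^sup>*\<Theta> = \<Theta>\<close> and antisymmetrizing removes all second derivatives
  and leaves \<open>dF\<^sub>1 \<and> dF\<^sub>2 = dx \<and> dy\<close>. Hence \<open>F\<^sub>1\<close> and \<open>F\<^sub>2\<close> do not depend on \<open>t\<close>, and compatibility
  with \<open>J\<close> gives the Cauchy-Riemann equations for \<open>F\<^sub>1 + i F\<^sub>2\<close> with derivative \<open>a + i b\<close> of modulus 1.
  Differentiating \<open>a\<^sup>2 + b\<^sup>2 = 1\<close> along both axes gives two linear equations that force the
  derivatives of \<open>a\<close> and \<open>b\<close> to vanish.\<close>
lemma PSH1_horizontal_derivative_constant:
  assumes "F \<in> PSH1"
  obtains a b where "a\<^sup>2 + b\<^sup>2 = 1"
    and "\<And>p v. frechet_derivative F (at p) v $ 1 = a * v$1 - b * v$2"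
    and "\<And>p v. frechet_derivative F (at p) v $ 2 = b * v$1 + a * v$2"
proof -
  define D where "D p = frechet_derivative F (at p)" for p
  define H where "H p v = frechet_derivative (\<lambda>x. D x v) (at p)" for p v
  have smooth: "smooth_on UNIV F"
    using assms by (simp add: PSH1_def diffeomorphism_def)
  have contact: "contact_form (F p) (D p v) = contact_form p v" for p v
    using assms by (simp add: PSH1_def D_def)
  have J: "D p (J p v) = J (F p) (D p v)" if "v \<in> contact_plane p" for p v
    using assms that by (simp add: PSH1_def D_def)
  have dF: "(F has_derivative D p) (at p)" for p
    using smooth_on_has_derivative[OF smooth] by (simp add: D_def)
  have dD: "((\<lambda>x. D x v) has_derivative H p v) (at p)" for p v
    using smooth_on_has_derivative[OF smooth_on_frechet_derivative[OF smooth]]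
    by (simp add: D_def H_def)
  have sym: "H p v w = H p w v" for p v w
    unfolding H_def D_def by (rule smooth_on_second_derivative_symmetric[OF smooth])
  note nth = has_derivative_vec_nth
  have lin: "linear (D p)" for p
    using dF has_derivative_linear by blast
  have expand: "D p v = v$1 *\<^sub>R D p (axis 1 1) + v$2 *\<^sub>R D p (axis 2 1) + v$3 *\<^sub>R D p (axis 3 1)" for p v
    by (subst vec3_expand[of v]) (simp add: linear_add[OF lin] linear_cmul[OF lin])

  \<comment> \<open>\<open>dF\<^sub>1 \<and> dF\<^sub>2 = dx \<and> dy\<close>, from the derivative in direction \<open>w\<close> of \<open>F\<^sup>*\<Theta>(v) = \<Theta>(v)\<close>\<close>
  have area: "D p w $ 1 * D p v $ 2 - D p w $ 2 * D p v $ 1 = w$1 * v$2 - w$2 * v$1" for p v w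
  proof -
    have *: "H p v w $ 3 + (F p $ 1 * H p v w $ 2 + D p w $ 1 * D p v $ 2)
        - (F p $ 2 * H p v w $ 1 + D p w $ 2 * D p v $ 1) = w$1 * v$2 - w$2 * v$1" for v w
    proof -
      have "((\<lambda>x. contact_form (F x) (D x v)) has_derivative
         (\<lambda>w. H p v w $ 3 + (F p $ 1 * H p v w $ 2 + D p w $ 1 * D p v $ 2)
           - (F p $ 2 * H p v w $ 1 + D p w $ 2 * D p v $ 1))) (at p)"
        unfolding contact_form_def
        by (intro has_derivative_add has_derivative_diff has_derivative_mult nth dF dD)
      then have 1: "((\<lambda>x. contact_form x v) has_derivative
         (\<lambda>w. H p v w $ 3 + (F p $ 1 * H p v w $ 2 + D p w $ 1 * D p v $ 2)
           - (F p $ 2 * H p v w $ 1 + D p w $ 2 * D p v $ 1))) (at p)"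
        by (simp only: contact)
      have 2: "((\<lambda>x. contact_form x v) has_derivative (\<lambda>w. w$1 * v$2 - w$2 * v$1)) (at p)"
        unfolding contact_form_def by (auto intro!: derivative_eq_intros nth)
      show ?thesis
        using fun_cong[OF has_derivative_unique[OF 1 2], of w] .
    qed
    show ?thesis
      using *[of v w] *[of w v] unfolding sym[of p v w] by algebra
  qed

  have vertical: "D p (axis 3 1) $ 1 = 0" "D p (axis 3 1) $ 2 = 0" for p
  proof -
    let ?T = "D p (axis 3 1)" and ?X = "D p (axis 1 1)" and ?Y = "D p (axis 2 1)"
    have "?X $ 1 * ?T $ 2 - ?X $ 2 * ?T $ 1 = 0" "?Y $ 1 * ?T $ 2 - ?Y $ 2 * ?T $ 1 = 0"
      "?X $ 1 * ?Y $ 2 - ?X $ 2 * ?Y $ 1 = 1"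
      unfolding area by (simp_all add: axis_def)
    moreover have "?T $ 1 * (?X $ 1 * ?Y $ 2 - ?X $ 2 * ?Y $ 1) =
        ?Y $ 1 * (?X $ 1 * ?T $ 2 - ?X $ 2 * ?T $ 1) - ?X $ 1 * (?Y $ 1 * ?T $ 2 - ?Y $ 2 * ?T $ 1)"
      "?T $ 2 * (?X $ 1 * ?Y $ 2 - ?X $ 2 * ?Y $ 1) =
        ?Y $ 2 * (?X $ 1 * ?T $ 2 - ?X $ 2 * ?T $ 1) - ?X $ 2 * (?Y $ 1 * ?T $ 2 - ?Y $ 2 * ?T $ 1)"
      by (simp_all add: algebra_simps)
    ultimately show "?T $ 1 = 0" "?T $ 2 = 0"
      by simp_all
  qed

  define a where "a p = D p (axis 1 1) $ 1" for p
  define b where "b p = D p (axis 1 1) $ 2" for p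
  \<comment> \<open>Cauchy-Riemann equations, from \<open>J e\<^sub>1 = e\<^sub>2\<close>; by the previous step \<open>e\<^sub>1, e\<^sub>2\<close> have the same
    horizontal images as the first two coordinate vectors\<close>
  have CR: "D p (axis 2 1) $ 1 = - b p" "D p (axis 2 1) $ 2 = a p" for p
  proof -
    have "frame1 p \<in> contact_plane p"
      by (simp add: contact_plane_def span_base)
    from J[OF this] have "D p (frame2 p) = J (F p) (D p (frame1 p))"
      by (simp add: J_def frame1_def)
    then have "D p (frame2 p) $ 1 = - D p (frame1 p) $ 2" "D p (frame2 p) $ 2 = D p (frame1 p) $ 1"
      by (simp_all add: J_def frame1_def frame2_def)
    then show "D p (axis 2 1) $ 1 = - b p" "D p (axis 2 1) $ 2 = a p"
      using expand[of p "frame1 p"] expand[of p "frame2 p"] vertical[of p]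
      by (simp_all add: frame1_def frame2_def a_def b_def)
  qed
  have norm: "a p * a p + b p * b p = 1" for p
    using area[of p "axis 1 1" "axis 2 1"] CR[of p] by (simp add: a_def b_def axis_def)

  have da: "(a has_derivative (\<lambda>w. H p (axis 1 1) w $ 1)) (at p)"
    and db: "(b has_derivative (\<lambda>w. H p (axis 1 1) w $ 2)) (at p)" for p
    unfolding a_def[abs_def] b_def[abs_def] by (intro nth dD)+
  have zero: "H p (axis 1 1) w $ 1 = 0" "H p (axis 1 1) w $ 2 = 0" for p w
  proof -
    define A where "A w = H p (axis 1 1) w $ 1" for w
    define B where "B w = H p (axis 1 1) w $ 2" for w
    have "(\<lambda>x. D x (axis 2 1) $ 1) = (\<lambda>x. - b x)" "(\<lambda>x. D x (axis 2 1) $ 2) = a"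
      "(\<lambda>x. D x (axis 3 1) $ 1) = (\<lambda>x. 0)" "(\<lambda>x. D x (axis 3 1) $ 2) = (\<lambda>x. 0)"
      using CR vertical by (auto simp: fun_eq_iff)
    then have H: "(\<lambda>w. H p (axis 2 1) w $ 1) = (\<lambda>w. - B w)" "(\<lambda>w. H p (axis 2 1) w $ 2) = A"
      "(\<lambda>w. H p (axis 3 1) w $ 1) = (\<lambda>w. 0)" "(\<lambda>w. H p (axis 3 1) w $ 2) = (\<lambda>w. 0)"
      using nth[OF dD[of "axis 2 1" p], where i = 1] nth[OF dD[of "axis 2 1" p], where i = 2]
        nth[OF dD[of "axis 3 1" p], where i = 1] nth[OF dD[of "axis 3 1" p], where i = 2]
        da[of p] has_derivative_minus[OF db[of p]]
      unfolding A_def B_def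
      by (auto dest: has_derivative_unique has_derivative_unique[OF _ has_derivative_const])
    have ort: "2 * (a p * A w + b p * B w) = 0" for w
    proof -
      have "((\<lambda>x. a x * a x + b x * b x) has_derivative
          (\<lambda>w. (a p * A w + A w * a p) + (b p * B w + B w * b p))) (at p)"
        unfolding A_def B_def by (intro has_derivative_add has_derivative_mult da db)
      then have "(\<lambda>w. (a p * A w + A w * a p) + (b p * B w + B w * b p)) = (\<lambda>w. 0)"
        unfolding norm using has_derivative_unique has_derivative_const by blast
      from fun_cong[OF this, of w] show ?thesis
        by (simp add: algebra_simps)
    qed
    have AB: "A (axis 2 1) = - B (axis 1 1)" "B (axis 2 1) = A (axis 1 1)"
      "A (axis 3 1) = 0" "B (axis 3 1) = 0"
      using fun_cong[OF H(1), of "axis 1 1"] fun_cong[OF H(2), of "axis 1 1"]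
        fun_cong[OF H(3), of "axis 1 1"] fun_cong[OF H(4), of "axis 1 1"]
      unfolding A_def B_def by (simp_all add: sym[of p "axis 1 1" "axis 2 1"] sym[of p "axis 1 1" "axis 3 1"])
    moreover have "A (axis 1 1) = 0" "B (axis 1 1) = 0"
    proof -
      let ?A = "A (axis 1 1)" and ?B = "B (axis 1 1)"
      have "a p * ?A + b p * ?B = 0" "b p * ?A - a p * ?B = 0"
        using ort[of "axis 1 1"] ort[of "axis 2 1"] AB by simp_all
      moreover have "?A * (a p * a p + b p * b p) =
          a p * (a p * ?A + b p * ?B) + b p * (b p * ?A - a p * ?B)"
        "?B * (a p * a p + b p * b p) =
          b p * (a p * ?A + b p * ?B) - a p * (b p * ?A - a p * ?B)"
        by (simp_all add: algebra_simps)
      ultimately show "?A = 0" "?B = 0"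
        by (simp_all only: norm mult_1_right mult_zero_right add_0_right diff_0_right)
    qed
    ultimately have "A (axis i 1) = 0 \<and> B (axis i 1) = 0" for i
      using exhaust_3[of i] by auto
    moreover have "linear A" "linear B"
      using has_derivative_linear[OF da[of p]] has_derivative_linear[OF db[of p]]
      unfolding A_def[abs_def] B_def[abs_def] .
    ultimately have "A w = 0" "B w = 0"
      by (subst vec3_expand[of w], simp add: linear_add linear_cmul)+
    then show "H p (axis 1 1) w $ 1 = 0" "H p (axis 1 1) w $ 2 = 0"
      by (simp_all add: A_def B_def)
  qed
  have const: "a p = a 0" "b p = b 0" for p
    using da db constant_if_zero_derivative[of a p 0] constant_if_zero_derivative[of b p 0]
    unfolding zero by blast+
  have "frechet_derivative F (at p) v $ 1 = a 0 * v$1 - b 0 * v$2"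
    "frechet_derivative F (at p) v $ 2 = b 0 * v$1 + a 0 * v$2" for p v
    using expand[of p v] CR[of p] vertical[of p] const[of p]
    by (simp_all add: D_def[symmetric] a_def[symmetric] b_def[symmetric])
  then show thesis
    using norm[of 0] that by (simp add: power2_eq_square)
qed

text \<open>The motion with the same constant horizontal derivative and the same image of the origin has
  the same first two components. The contact form then determines the derivative of the third one.\<close>
lemma PSH1_imp_motion:
  assumes "F \<in> PSH1"
  obtains \<phi> where "0 \<le> \<phi>" "\<phi> < 2 * pi" "F = motion (F 0) \<phi>"
proof -
  obtain a b where ab: "a\<^sup>2 + b\<^sup>2 = 1"
    "\<And>p v. frechet_derivative F (at p) v $ 1 = a * v$1 - b * v$2"
    "\<And>p v. frechet_derivative F (at p) v $ 2 = b * v$1 + a * v$2"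
    using PSH1_horizontal_derivative_constant[OF assms] by metis
  obtain \<phi> where \<phi>: "0 \<le> \<phi>" "\<phi> < 2 * pi" "a = cos \<phi>" "b = sin \<phi>"
    using sincos_total_2pi[OF ab(1)] by metis
  let ?G = "motion (F 0) \<phi>"
  have G: "?G \<in> PSH1"
    by (rule motion_in_PSH1)
  have dF: "(F has_derivative frechet_derivative F (at p)) (at p)" for p
    using assms smooth_on_has_derivative by (auto simp: PSH1_def diffeomorphism_def)
  have dG: "(?G has_derivative motion_linear (F 0) \<phi>) (at p)" for p
    by (rule motion_has_derivative)
  note nth = has_derivative_vec_nth
  have eq: "F p $ i = ?G p $ i"
    if "\<And>p v. frechet_derivative F (at p) v $ i = motion_linear (F 0) \<phi> v $ i" for i p
  proof -
    have "((\<lambda>x. F x $ i - ?G x $ i) has_derivative (\<lambda>_. 0)) (at x)" for x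
      using has_derivative_diff[OF nth[OF dF[of x], where i = i] nth[OF dG[of x], where i = i]]
      by (simp add: that)
    from constant_if_zero_derivative[OF this, of p 0] show ?thesis
      by simp
  qed
  have 1: "F p $ 1 = ?G p $ 1" and 2: "F p $ 2 = ?G p $ 2" for p
    by (rule eq, simp add: ab \<phi> motion_linear_def)+
  have "frechet_derivative F (at p) v $ 3 = motion_linear (F 0) \<phi> v $ 3" for p v
  proof -
    have "contact_form (F p) (frechet_derivative F (at p) v) =
        contact_form (?G p) (frechet_derivative ?G (at p) v)"
      using assms G by (simp only: PSH1_def mem_Collect_eq)
    then show ?thesis
      by (simp add: contact_form_def 1 2 ab(2,3) \<phi>(3,4)) (simp add: motion_linear_def)
  qed
  then have 3: "F p $ 3 = ?G p $ 3" for p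
    by (rule eq)
  have "F = ?G"
    using 1 2 3 by (simp add: fun_eq_iff vec_eq_iff forall_3)
  then show thesis
    using that \<phi>(1,2) by blast
qed

lemma motion_angle_motion:
  assumes "0 \<le> \<phi>" "\<phi> < 2 * pi"
  shows "motion_angle (motion Q \<phi>) = \<phi>"
proof -
  have frame: "motion_linear Q \<phi> (frame1 0) = cos \<psi> *\<^sub>R frame1 Q + sin \<psi> *\<^sub>R frame2 Q \<longleftrightarrow>
      cos \<phi> = cos \<psi> \<and> sin \<phi> = sin \<psi>" for \<psi>
    by (simp add: motion_linear_def frame1_def frame2_def vec_eq_iff forall_3 algebra_simps) metis
  show ?thesis
    unfolding motion_angle_def
  proof (rule the_equality)
    fix \<psi>
    assume "0 \<le> \<psi> \<and> \<psi> < 2 * pi \<and>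
        frechet_derivative (motion Q \<phi>) (at 0) (frame1 0) =
        cos \<psi> *\<^sub>R frame1 (motion Q \<phi> 0) + sin \<psi> *\<^sub>R frame2 (motion Q \<phi> 0)"
    then have \<psi>: "0 \<le> \<psi>" "\<psi> < 2 * pi" "sin \<psi> = sin \<phi> \<and> cos \<psi> = cos \<phi>"
      by (simp_all add: frame)
    then obtain n :: int where n: "\<psi> = \<phi> + 2 * pi * n"
      using sin_cos_eq_iff[of \<psi> \<phi>] by auto
    then have "\<bar>2 * pi * n\<bar> < 2 * pi * 1"
      using assms \<psi>(1,2) by linarith
    then have "\<bar>real_of_int n\<bar> < 1"
      by (simp add: abs_mult)
    then show "\<psi> = \<phi>"
      using n by simp
  qed (use assms in \<open>simp add: frame\<close>)
qed

lemma motion_coordinates_image: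
  "(\<lambda>F. (F 0, motion_angle F)) ` {F \<in> PSH1. P F} =
     {(Q, \<phi>). 0 \<le> \<phi> \<and> \<phi> < 2 * pi \<and> P (motion Q \<phi>)}"
proof (intro set_eqI iffI)
  fix z
  assume "z \<in> (\<lambda>F. (F 0, motion_angle F)) ` {F \<in> PSH1. P F}"
  then obtain F where F: "F \<in> PSH1" "P F" "z = (F 0, motion_angle F)"
    by auto
  obtain \<phi> where "0 \<le> \<phi>" "\<phi> < 2 * pi" "F = motion (F 0) \<phi>"
    using PSH1_imp_motion[OF F(1)] .
  then show "z \<in> {(Q, \<phi>). 0 \<le> \<phi> \<and> \<phi> < 2 * pi \<and> P (motion Q \<phi>)}"
    using F motion_angle_motion[of \<phi> "F 0"] by simp
next
  fix z
  assume "z \<in> {(Q, \<phi>). 0 \<le> \<phi> \<and> \<phi> < 2 * pi \<and> P (motion Q \<phi>)}"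
  then obtain Q \<phi> where "z = (Q, \<phi>)" "0 \<le> \<phi>" "\<phi> < 2 * pi" "P (motion Q \<phi>)"
    by auto
  then show "z \<in> (\<lambda>F. (F 0, motion_angle F)) ` {F \<in> PSH1. P F}"
    using motion_in_PSH1 motion_angle_motion by (intro image_eqI[of _ _ "motion Q \<phi>"]) auto
qed


section \<open>Coordinates along horizontal lines\<close>

lemma lborel_distr_unimodular:
  fixes g h :: "real^'n::{finite,wellorder} \<Rightarrow> real^'n::_"
  assumes hg: "\<And>x. h (g x) = x" and gh: "\<And>y. g (h y) = y"
    and cont: "continuous_on UNIV g"
    and der: "\<And>y. (h has_derivative h' y) (at y)"
    and det: "\<And>y. \<bar>det (matrix (h' y))\<bar> = 1"
  shows "distr lborel borel g = lborel"
proof (rule lborel_eqI[symmetric])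
  fix l u :: "real^'n::_"
  assume "\<And>b. b \<in> Basis \<Longrightarrow> l \<bullet> b \<le> u \<bullet> b"
  then have box: "emeasure lborel (box l u) = ennreal (\<Prod>b\<in>Basis. (u - l) \<bullet> b)"
    by (rule emeasure_lborel_box)
  have g: "g \<in> borel_measurable lborel"
    using borel_measurable_continuous_onI[OF cont] by simp
  have vimage: "g -` box l u = h ` box l u"
  proof (intro equalityI subsetI)
    show "x \<in> h ` box l u" if "x \<in> g -` box l u" for x
      using that hg[of x] by (intro image_eqI[of _ _ "g x"]) auto
    show "x \<in> g -` box l u" if "x \<in> h ` box l u" for x
      using that gh by auto
  qed
  have box_meas: "box l u \<in> lmeasurable"
    by simp
  have "h ` box l u \<in> lmeasurable \<and> measure lebesgue (h ` box l u) = measure lebesgue (box l u)"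
  proof (subst has_measure_differentiable_image[where f' = h'])
    show "((\<lambda>x. \<bar>det (matrix (h' x))\<bar>) has_integral measure lebesgue (box l u)) (box l u)"
      using box_meas has_integral_integral lmeasurable_iff_integrable_on lmeasure_integral
      unfolding det by metis
    show "inj_on h (box l u)"
      using gh by (metis inj_onI)
    show "(h has_derivative h' y) (at y within box l u)" for y
      by (rule has_derivative_at_withinI[OF der])
  qed simp
  then have "emeasure lebesgue (h ` box l u) = emeasure lebesgue (box l u)"
    using emeasure_eq_measure2[OF box_meas] emeasure_eq_measure2[of "h ` box l u" lebesgue]
    by metis
  moreover have "g -` box l u \<in> sets lborel"
    using measurable_sets[OF g, of "box l u"] by simp
  ultimately have "emeasure lborel (g -` box l u) = emeasure lborel (box l u)"
    by (simp add: vimage)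
  then show "emeasure (distr lborel borel g) (box l u) = ennreal (\<Prod>b\<in>Basis. (u - l) \<bullet> b)"
    using g box by (simp add: emeasure_distr)
qed simp

lemma prod_Basis_vec:
  fixes x :: "real^'n"
  shows "(\<Prod>b\<in>Basis. x \<bullet> b) = (\<Prod>i\<in>UNIV. x $ i)"
proof -
  have 1: "Basis = (\<lambda>i. axis i 1 :: real^'n) ` UNIV"
    by (auto simp: Basis_vec_def)
  have 2: "inj (\<lambda>i. axis i 1 :: real^'n)"
    by (auto intro!: injI simp: axis_eq_axis)
  show ?thesis
    unfolding 1 by (subst prod.reindex[OF 2]) (simp add: inner_axis)
qed

text \<open>The isometry that splits off the first coordinate; it makes the product structure of Lebesgue
  measure available on \<open>real^3\<close>.\<close>
definition vec_cons :: "real \<times> (real^2) \<Rightarrow> real^3" where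
  "vec_cons = (\<lambda>(\<sigma>, z). vector [\<sigma>, z$1, z$2])"

lemma continuous_on_vector_3 [continuous_intros]:
  fixes f g h :: "'a::t2_space \<Rightarrow> real"
  assumes "continuous_on S f" "continuous_on S g" "continuous_on S h"
  shows "continuous_on S (\<lambda>x. vector [f x, g x, h x] :: real^3)"
  unfolding continuous_on_componentwise[where f = "\<lambda>x. vector [f x, g x, h x] :: real^3"]
    Basis_vec_def
  using assms by (auto simp: inner_axis forall_3)

lemma lborel_distr_vec_cons: "distr lborel borel vec_cons = lborel"
proof (rule lborel_eqI[symmetric])
  fix l u :: "real^3"
  assume le: "\<And>b. b \<in> Basis \<Longrightarrow> l \<bullet> b \<le> u \<bullet> b"
  have le: "l $ i \<le> u $ i" for i
    using le[of "axis i 1"] by (simp add: inner_axis)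
  have "continuous_on UNIV vec_cons"
    unfolding vec_cons_def case_prod_unfold by (intro continuous_intros)
  then have meas: "vec_cons \<in> borel_measurable lborel"
    using borel_measurable_continuous_onI by simp
  define l' u' where "l' = (vector [l$2, l$3] :: real^2)" and "u' = (vector [u$2, u$3] :: real^2)"
  have "l' $ i \<le> u' $ i" for i
    using le exhaust_2[of i] by (auto simp: l'_def u'_def)
  then have "b \<in> Basis \<Longrightarrow> l' \<bullet> b \<le> u' \<bullet> b" for b
    by (auto simp: Basis_vec_def inner_axis)
  then have 2: "emeasure lborel (box l' u') = ennreal ((u$2 - l$2) * (u$3 - l$3))"
    by (subst emeasure_lborel_box)
      (auto simp: prod_Basis_vec UNIV_2 l'_def u'_def)
  have "vec_cons -` box l u = {l$1<..<u$1} \<times> box l' u'"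
    by (auto simp: vec_cons_def mem_box_cart forall_3 forall_2 l'_def u'_def)
  then have "emeasure lborel (vec_cons -` box l u) =
      emeasure (lborel \<Otimes>\<^sub>M lborel) ({l$1<..<u$1} \<times> box l' u')"
    by (simp add: lborel_prod)
  also have "\<dots> = ennreal (u$1 - l$1) * ennreal ((u$2 - l$2) * (u$3 - l$3))"
    using le[of 1] 2 by (subst lborel.emeasure_pair_measure_Times) auto
  also have "\<dots> = ennreal ((u$1 - l$1) * ((u$2 - l$2) * (u$3 - l$3)))"
    using le[of 1] le[of 2] le[of 3] by (intro ennreal_mult[symmetric]) auto
  also have "(u$1 - l$1) * ((u$2 - l$2) * (u$3 - l$3)) = (\<Prod>b\<in>Basis. (u - l) \<bullet> b)"
    unfolding prod_Basis_vec UNIV_3 by simp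
  finally show "emeasure (distr lborel borel vec_cons) (box l u) = ennreal (\<Prod>b\<in>Basis. (u - l) \<bullet> b)"
    using emeasure_distr[OF meas, of "box l u"] by simp
qed simp

text \<open>The left-invariant vector field \<open>cos \<theta> e\<^sub>1 + sin \<theta> e\<^sub>2\<close>, with \<open>e\<^sub>1, e\<^sub>2\<close> the standard
  horizontal frame at \<open>P\<close>.\<close>
definition horizontal_direction :: "real \<Rightarrow> real^3 \<Rightarrow> real^3" where
  "horizontal_direction \<theta> P = vector [cos \<theta>, sin \<theta>, P$2 * cos \<theta> - P$1 * sin \<theta>]"

text \<open>With \<open>\<sigma> = x cos \<theta> + y sin \<theta>\<close> and \<open>\<eta> = y cos \<theta> - x sin \<theta>\<close>, the integral curves of the field
  above have \<open>\<sigma>' = 1\<close>, \<open>\<eta>' = 0\<close> and \<open>t' = \<eta>\<close>; so \<open>(\<eta>, t - \<sigma> \<eta>)\<close> is constant on each of them and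
  distinguishes them.\<close>
definition shadow :: "real \<Rightarrow> real^3 \<Rightarrow> real^2" where
  "shadow \<theta> P = vector [P$2 * cos \<theta> - P$1 * sin \<theta>,
     P$3 - (P$1 * cos \<theta> + P$2 * sin \<theta>) * (P$2 * cos \<theta> - P$1 * sin \<theta>)]"

text \<open>The inverse of \<open>P \<mapsto> (\<sigma>, shadow \<theta> P)\<close>.\<close>
definition line_point :: "real \<Rightarrow> real \<Rightarrow> real^2 \<Rightarrow> real^3" where
  "line_point \<theta> \<sigma> z =
     vector [\<sigma> * cos \<theta> - z$1 * sin \<theta>, \<sigma> * sin \<theta> + z$1 * cos \<theta>, z$2 + \<sigma> * z$1]"

lemma horizontal_direction_along_line [simp]:
  "horizontal_direction \<theta> (P + r *\<^sub>R horizontal_direction \<theta> P) = horizontal_direction \<theta> P"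
  by (simp add: horizontal_direction_def vec_eq_iff forall_3 algebra_simps)

lemma line_point_add:
  "line_point \<theta> (\<sigma> + r) z = line_point \<theta> \<sigma> z + r *\<^sub>R horizontal_direction \<theta> (line_point \<theta> \<sigma> z)"
  by (simp add: line_point_def horizontal_direction_def vec_eq_iff forall_3,
      insert sin_cos_squared_add[of \<theta>], algebra)

lemma shadow_line_point [simp]: "shadow \<theta> (line_point \<theta> \<sigma> z) = z"
  by (simp add: line_point_def shadow_def vec_eq_iff forall_2,
      insert sin_cos_squared_add[of \<theta>], algebra)

lemma line_point_shadow: "line_point \<theta> (P$1 * cos \<theta> + P$2 * sin \<theta>) (shadow \<theta> P) = P"
  by (simp add: line_point_def shadow_def vec_eq_iff forall_3,
      insert sin_cos_squared_add[of \<theta>], algebra)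

lemma shadow_along_line [simp]: "shadow \<theta> (P + r *\<^sub>R horizontal_direction \<theta> P) = shadow \<theta> P"
  using line_point_add[of \<theta> "P$1 * cos \<theta> + P$2 * sin \<theta>" r "shadow \<theta> P"] shadow_line_point
  unfolding line_point_shadow by metis

lemma shadow_eq_imp_same_line:
  assumes "shadow \<theta> P = shadow \<theta> P'"
  obtains r where "P' = P + r *\<^sub>R horizontal_direction \<theta> P"
proof -
  let ?\<sigma> = "\<lambda>P. P$1 * cos \<theta> + P$2 * sin \<theta>"
  define r where "r = ?\<sigma> P' - ?\<sigma> P"
  have r: "?\<sigma> P + r = ?\<sigma> P'"
    by (simp add: r_def)
  have "line_point \<theta> (?\<sigma> P + r) (shadow \<theta> P) = P'"
    unfolding r assms by (rule line_point_shadow)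
  then have "P' = P + r *\<^sub>R horizontal_direction \<theta> P"
    unfolding line_point_add[of \<theta> "?\<sigma> P" r] line_point_shadow by (rule sym)
  then show thesis
    by (rule that)
qed

lemma continuous_on_line_point [continuous_intros]:
  fixes f g :: "'a::t2_space \<Rightarrow> real"
  assumes "continuous_on S f" "continuous_on S g" "continuous_on S h"
  shows "continuous_on S (\<lambda>x. line_point (f x) (g x) (h x))"
  unfolding line_point_def by (intro continuous_intros assms)

text \<open>The coordinate change is a rotation of the \<open>(x, y)\<close>-plane and a shear in \<open>t\<close>, so its Jacobian
  determinant is 1.\<close>
lemma lborel_distr_line_point:
  "distr lborel borel (\<lambda>(\<sigma>, z). line_point \<theta> \<sigma> z) = lborel"
proof -
  define g where "g w = line_point \<theta> (w$1) (vector [w$2, w$3])" for w :: "real^3"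
  define h where "h P = (vector [P$1 * cos \<theta> + P$2 * sin \<theta>, P$2 * cos \<theta> - P$1 * sin \<theta>,
     P$3 - (P$1 * cos \<theta> + P$2 * sin \<theta>) * (P$2 * cos \<theta> - P$1 * sin \<theta>)] :: real^3)" for P :: "real^3"
  define h' where "h' P v = (vector [v$1 * cos \<theta> + v$2 * sin \<theta>, v$2 * cos \<theta> - v$1 * sin \<theta>,
     v$3 - ((P$1 * cos \<theta> + P$2 * sin \<theta>) * (v$2 * cos \<theta> - v$1 * sin \<theta>)
       + (v$1 * cos \<theta> + v$2 * sin \<theta>) * (P$2 * cos \<theta> - P$1 * sin \<theta>))] :: real^3)" for P v :: "real^3"
  have "distr lborel borel g = lborel"
  proof (rule lborel_distr_unimodular)
    show "h (g x) = x" for x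
      by (simp add: g_def h_def line_point_def vec_eq_iff forall_3,
          insert sin_cos_squared_add[of \<theta>], algebra)
    show "g (h y) = y" for y
      by (simp add: g_def h_def line_point_def vec_eq_iff forall_3,
          insert sin_cos_squared_add[of \<theta>], algebra)
    show "continuous_on UNIV g"
      unfolding g_def line_point_def vector_2 by (intro continuous_intros)
    show "(h has_derivative h' y) (at y)" for y
      unfolding has_derivative_componentwise_within[of h] Basis_vec_def
      by (auto simp: inner_axis forall_3 h_def h'_def
          intro!: derivative_eq_intros bounded_linear.has_derivative[OF bounded_linear_vec_nth])
    show "\<bar>det (matrix (h' y))\<bar> = 1" for y
    proof -
      have "det (matrix (h' y)) = cos \<theta> * cos \<theta> + sin \<theta> * sin \<theta>"
        by (simp add: det_3 matrix_def h'_def axis_def)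
      then show ?thesis
        by (simp flip: power2_eq_square)
    qed
  qed
  note g = this
  have eq: "(\<lambda>(\<sigma>, z). line_point \<theta> \<sigma> z) = g \<circ> vec_cons"
    by (simp add: fun_eq_iff g_def vec_cons_def line_point_def)
  have "continuous_on UNIV g" "continuous_on UNIV vec_cons"
    unfolding g_def line_point_def vector_2 vec_cons_def case_prod_unfold
    by (intro continuous_intros)+
  then have "distr lborel borel (g \<circ> vec_cons) = distr (distr lborel borel vec_cons) borel g"
    by (intro distr_distr[symmetric]) (simp_all add: borel_measurable_continuous_onI)
  then show ?thesis
    by (simp only: eq lborel_distr_vec_cons g)
qed


section \<open>Motions of a segment at a fixed angle\<close>

lemma contact_plane_eq: "contact_plane P = {v. contact_form P v = 0}"
proof (intro equalityI subsetI)
  fix v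
  assume "v \<in> contact_plane P"
  then obtain a b where "v = a *\<^sub>R frame1 P + b *\<^sub>R frame2 P"
    by (auto simp: contact_plane_def span_insert algebra_simps)
  then show "v \<in> {v. contact_form P v = 0}"
    by (simp add: contact_form_def frame1_def frame2_def algebra_simps)
next
  fix v
  assume "v \<in> {v. contact_form P v = 0}"
  then have "v = v$1 *\<^sub>R frame1 P + v$2 *\<^sub>R frame2 P"
    by (simp add: contact_form_def frame1_def frame2_def vec_eq_iff forall_3 algebra_simps)
  also have "\<dots> \<in> contact_plane P"
    unfolding contact_plane_def by (intro span_add span_scale span_base) auto
  finally show "v \<in> contact_plane P" .
qed

lemma polar_coordinates:
  fixes x y :: real
  obtains \<theta> where "x = sqrt (x\<^sup>2 + y\<^sup>2) * cos \<theta>" "y = sqrt (x\<^sup>2 + y\<^sup>2) * sin \<theta>"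
proof (cases "x\<^sup>2 + y\<^sup>2 = 0")
  case True
  then show thesis
    using that[of 0] by (simp add: sum_power2_eq_zero_iff)
next
  case False
  define r where "r = sqrt (x\<^sup>2 + y\<^sup>2)"
  have r: "r > 0" "r\<^sup>2 = x\<^sup>2 + y\<^sup>2"
    using False by (simp_all add: r_def sum_power2_gt_zero_iff)
  have "(x / r)\<^sup>2 + (y / r)\<^sup>2 = 1"
    unfolding power_divide r(2) using False by (simp add: add_divide_distrib[symmetric])
  then obtain \<theta> where "x / r = cos \<theta>" "y / r = sin \<theta>"
    using sincos_total_2pi by metis
  then have "x = r * cos \<theta>" "y = r * sin \<theta>"
    using r(1) by (simp_all add: field_simps)
  then show thesis
    unfolding r_def by (rule that)
qed

lemma horizontal_segment_direction:
  assumes "horizontal (linepath p q)" "levi_length (linepath p q) = l"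
  obtains \<theta> where "0 \<le> l" "q = p + l *\<^sub>R horizontal_direction \<theta> p"
proof -
  define v where "v = q - p"
  have "levi_norm (contact_part P v) = levi_norm v" for P
    by (simp add: levi_norm_def contact_part_def frameT_def)
  then have l: "l = sqrt ((v$1)\<^sup>2 + (v$2)\<^sup>2)"
    using assms(2) by (simp add: levi_length_def levi_norm_def v_def)
  obtain \<theta> where \<theta>: "v$1 = l * cos \<theta>" "v$2 = l * sin \<theta>"
    using polar_coordinates[of "v$1" "v$2"] unfolding l by metis
  have "v \<in> contact_plane (linepath p q 0)"
    using assms(1) unfolding horizontal_def v_def
    by (metis atLeastAtMost_iff order_refl vector_derivative_linepath_at zero_le_one)
  then have "contact_form p v = 0"
    by (simp add: contact_plane_eq linepath_def)
  then have "v = l *\<^sub>R horizontal_direction \<theta> p"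
    by (simp add: \<theta> contact_form_def horizontal_direction_def vec_eq_iff forall_3 algebra_simps)
  then have "q = p + l *\<^sub>R horizontal_direction \<theta> p"
    by (simp add: v_def algebra_simps)
  moreover have "0 \<le> l"
    using l by simp
  ultimately show thesis
    by (rule that[rotated])
qed

lemma emeasure_swept_interval:
  fixes I :: "real set"
  assumes "open I" "convex I" "bounded I" "I \<noteq> {}" "0 \<le> l"
  shows "emeasure lborel {\<sigma>. \<exists>s\<in>{0..l}. \<sigma> + s \<in> I} = emeasure lborel I + ennreal l"
proof -
  define a b where "a = Inf I" and "b = Sup I"
  have bdd: "bdd_below I" "bdd_above I"
    using assms(3) bounded_imp_bdd_below bounded_imp_bdd_above by auto
  have strict: "a < x \<and> x < b" if x: "x \<in> I" for x
  proof -
    obtain e where e: "e > 0" "ball x e \<subseteq> I"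
      using openE[OF assms(1) x] by blast
    have "x - e/2 \<in> ball x e" "x + e/2 \<in> ball x e"
      using e(1) by (simp_all add: dist_real_def)
    then have "x - e/2 \<in> I" "x + e/2 \<in> I"
      using e(2) by blast+
    then have "a \<le> x - e/2" "x + e/2 \<le> b"
      using bdd by (simp_all add: a_def b_def cInf_lower cSup_upper)
    then show ?thesis
      using e(1) by simp
  qed
  have "x \<in> I" if x: "a < x" "x < b" for x
  proof -
    obtain y where "y \<in> I" "y < x"
      using x(1) bdd assms(4) by (auto simp: a_def cInf_less_iff)
    moreover obtain z where "z \<in> I" "x < z"
      using x(2) bdd assms(4) by (auto simp: b_def less_cSup_iff)
    ultimately show ?thesis
      using mem_is_interval_1_I[of I y z x] assms(2) is_interval_convex_1 by auto
  qed
  with strict have I: "I = {a<..<b}"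
    by auto
  obtain x0 where "x0 \<in> I"
    using assms(4) by blast
  then have "a < b"
    using strict by fastforce
  have "\<exists>s\<in>{0..l}. \<sigma> + s \<in> I" if "\<sigma> \<in> {a - l<..<b}" for \<sigma>
  proof (cases "a < \<sigma>")
    case True
    then show ?thesis
      using that assms(5) by (intro bexI[of _ 0]) (auto simp: I)
  next
    case False
    have "a - \<sigma> < min l (b - \<sigma>)"
      using that \<open>a < b\<close> by auto
    then obtain s where "a - \<sigma> < s" "s < min l (b - \<sigma>)"
      using dense by blast
    then show ?thesis
      using False by (intro bexI[of _ s]) (auto simp: I)
  qed
  then have "{\<sigma>. \<exists>s\<in>{0..l}. \<sigma> + s \<in> I} = {a - l<..<b}"
    by (auto simp: I)
  then show ?thesis
    using \<open>a < b\<close> assms(5) by (simp add: I flip: ennreal_plus)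
qed

lemma line_point_measurable [measurable]:
  "(\<lambda>(\<sigma>, z). line_point \<theta> \<sigma> z) \<in> borel_measurable borel"
  unfolding case_prod_unfold
  by (intro borel_measurable_continuous_onI continuous_intros)

text \<open>Cavalieri's principle for the family of the lines in direction \<open>\<theta>\<close>.\<close>
lemma emeasure_by_lines:
  assumes "S \<in> sets borel"
  shows "emeasure lborel S = (\<integral>\<^sup>+ z. emeasure lborel {\<sigma>. line_point \<theta> \<sigma> z \<in> S} \<partial>lborel)"
proof -
  let ?f = "\<lambda>(\<sigma>, z). line_point \<theta> \<sigma> z"
  have f: "?f \<in> borel_measurable lborel"
    using line_point_measurable by simp
  have "emeasure lborel S = emeasure (distr lborel borel ?f) S"
    by (simp only: lborel_distr_line_point)
  also have "\<dots> = emeasure (lborel \<Otimes>\<^sub>M lborel) (?f -` S)"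
    using emeasure_distr[OF f, of S] assms by (simp add: lborel_prod)
  also have "\<dots> = (\<integral>\<^sup>+ z. emeasure lborel ((\<lambda>\<sigma>. (\<sigma>, z)) -` (?f -` S)) \<partial>lborel)"
  proof (rule lborel_pair.emeasure_pair_measure_alt2)
    show "?f -` S \<in> sets (lborel \<Otimes>\<^sub>M lborel)"
      unfolding lborel_prod using measurable_sets[OF f, of S] assms by simp
  qed
  finally show ?thesis
    by (simp add: vimage_def)
qed

lemma mem_shadow_iff: "z \<in> shadow \<theta> ` D \<longleftrightarrow> (\<exists>\<sigma>. line_point \<theta> \<sigma> z \<in> D)"
proof
  assume "z \<in> shadow \<theta> ` D"
  then obtain P where "P \<in> D" "z = shadow \<theta> P"
    by blast
  then have "line_point \<theta> (P$1 * cos \<theta> + P$2 * sin \<theta>) z \<in> D"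
    by (simp add: line_point_shadow)
  then show "\<exists>\<sigma>. line_point \<theta> \<sigma> z \<in> D"
    by blast
next
  assume "\<exists>\<sigma>. line_point \<theta> \<sigma> z \<in> D"
  then obtain \<sigma> where "line_point \<theta> \<sigma> z \<in> D"
    by blast
  then show "z \<in> shadow \<theta> ` D"
    by (intro image_eqI[of _ _ "line_point \<theta> \<sigma> z"]) simp_all
qed

lemma open_shadow:
  assumes "open D"
  shows "open (shadow \<theta> ` D)"
proof -
  have eq: "shadow \<theta> ` D = (\<Union>\<sigma>. line_point \<theta> \<sigma> -` D)"
    by (simp add: set_eq_iff mem_shadow_iff)
  have "continuous_on UNIV (line_point \<theta> \<sigma>)" for \<sigma>
    by (intro continuous_intros)
  then show ?thesis
    unfolding eq by (intro open_UN ballI open_vimage assms)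
qed

lemma continuous_on_horizontal_direction [continuous_intros]:
  fixes f :: "'a::t2_space \<Rightarrow> real"
  assumes "continuous_on S f" "continuous_on S g"
  shows "continuous_on S (\<lambda>x. horizontal_direction (f x) (g x))"
  unfolding horizontal_direction_def by (intro continuous_intros assms)

lemma open_swept:
  assumes "open D"
  shows "open {P. \<exists>s\<in>{0..l}. P + s *\<^sub>R horizontal_direction \<theta> P \<in> D}"
proof -
  have "{P. \<exists>s\<in>{0..l}. P + s *\<^sub>R horizontal_direction \<theta> P \<in> D} =
      (\<Union>s\<in>{0..l}. (\<lambda>P. P + s *\<^sub>R horizontal_direction \<theta> P) -` D)"
    by auto
  also have "open \<dots>"
    by (intro open_UN ballI open_vimage assms continuous_intros)
  finally show ?thesis .
qed

text \<open>Each line that meets \<open>D\<close> does so in a bounded open interval, by convexity. The points of the line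
  from which \<open>D\<close> is reached within distance \<open>l\<close> form the same interval, prolonged by \<open>l\<close> at its
  beginning; the lines that meet \<open>D\<close> are counted by the shadow.\<close>
lemma emeasure_swept:
  assumes D: "open D" "bounded D" "convex D" and "0 \<le> l"
  shows "emeasure lborel {P. \<exists>s\<in>{0..l}. P + s *\<^sub>R horizontal_direction \<theta> P \<in> D} =
    emeasure lborel D + ennreal l * emeasure lborel (shadow \<theta> ` D)"
proof -
  let ?G = "{P. \<exists>s\<in>{0..l}. P + s *\<^sub>R horizontal_direction \<theta> P \<in> D}"
  define I where "I z = {\<sigma>. line_point \<theta> \<sigma> z \<in> D}" for z
  have cont: "continuous_on UNIV (\<lambda>\<sigma>. line_point \<theta> \<sigma> z)" for z
    by (intro continuous_intros)
  have "I z = (\<lambda>\<sigma>. line_point \<theta> \<sigma> z) -` D" for z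
    by (auto simp: I_def)
  then have "open (I z)" for z
    using D(1) cont by (simp add: open_vimage)
  have "convex (I z)" for z
  proof (rule convexI)
    fix x y u v :: real
    assume *: "x \<in> I z" "y \<in> I z" "0 \<le> u" "0 \<le> v" "u + v = 1"
    have "line_point \<theta> (u * x + v * y) z = u *\<^sub>R line_point \<theta> x z + v *\<^sub>R line_point \<theta> y z"
      using *(5) by (simp add: line_point_def vec_eq_iff forall_3, algebra)
    then show "u *\<^sub>R x + v *\<^sub>R y \<in> I z"
      using convexD[OF D(3)] * by (simp add: I_def)
  qed
  have "bounded (I z)" for z
  proof -
    obtain B where B: "\<And>P. P \<in> D \<Longrightarrow> norm P \<le> B"
      using D(2) bounded_iff by blast
    have "norm \<sigma> \<le> B + B" if "\<sigma> \<in> I z" for \<sigma>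
    proof -
      let ?P = "line_point \<theta> \<sigma> z"
      have "\<sigma> = ?P$1 * cos \<theta> + ?P$2 * sin \<theta>"
        by (simp add: line_point_def, insert sin_cos_squared_add[of \<theta>], algebra)
      then have "\<bar>\<sigma>\<bar> \<le> \<bar>?P$1\<bar> * \<bar>cos \<theta>\<bar> + \<bar>?P$2\<bar> * \<bar>sin \<theta>\<bar>"
        by (metis abs_mult abs_triangle_ineq)
      also have "\<dots> \<le> norm ?P * 1 + norm ?P * 1"
        by (intro add_mono mult_mono component_le_norm_cart) auto
      finally show ?thesis
        using B[of ?P] that by (simp add: I_def)
    qed
    then show ?thesis
      by (auto simp: bounded_iff)
  qed
  have nonempty: "I z \<noteq> {} \<longleftrightarrow> z \<in> shadow \<theta> ` D" for z
    by (simp add: I_def mem_shadow_iff)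
  have slice: "emeasure lborel {\<sigma>. line_point \<theta> \<sigma> z \<in> ?G} =
      emeasure lborel (I z) + ennreal l * indicator (shadow \<theta> ` D) z" for z
  proof -
    have eq: "{\<sigma>. line_point \<theta> \<sigma> z \<in> ?G} = {\<sigma>. \<exists>s\<in>{0..l}. \<sigma> + s \<in> I z}"
      by (simp add: I_def line_point_add)
    show ?thesis
    proof (cases "I z = {}")
      case True
      then show ?thesis
        unfolding eq using nonempty[of z] by simp
    next
      case False
      then show ?thesis
        unfolding eq using nonempty[of z] \<open>open (I z)\<close> \<open>convex (I z)\<close> \<open>bounded (I z)\<close> \<open>0 \<le> l\<close>
        by (simp add: emeasure_swept_interval)
    qed
  qed
  have shadow_borel: "shadow \<theta> ` D \<in> sets borel"
    using open_shadow[OF D(1)] by simp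
  have "(\<lambda>z. emeasure lborel ((\<lambda>\<sigma>. (\<sigma>, z)) -` ((\<lambda>(\<sigma>, z). line_point \<theta> \<sigma> z) -` D)))
      \<in> borel_measurable (lborel :: (real^2) measure)"
  proof (rule lborel_pair.measurable_emeasure_Pair2)
    show "(\<lambda>(\<sigma>, z). line_point \<theta> \<sigma> z) -` D \<in> sets (lborel \<Otimes>\<^sub>M lborel)"
      unfolding lborel_prod using measurable_sets[OF line_point_measurable, of D \<theta>] D(1) by simp
  qed
  then have meas: "(\<lambda>z. emeasure lborel (I z)) \<in> borel_measurable lborel"
    by (simp add: I_def vimage_def)
  have "emeasure lborel ?G = (\<integral>\<^sup>+ z. emeasure lborel (I z) + ennreal l * indicator (shadow \<theta> ` D) z \<partial>lborel)"
    using emeasure_by_lines[of ?G \<theta>] open_swept[OF D(1), of l \<theta>] unfolding slice by simp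
  also have "\<dots> = (\<integral>\<^sup>+ z. emeasure lborel (I z) \<partial>lborel) + ennreal l * emeasure lborel (shadow \<theta> ` D)"
    using meas shadow_borel by (subst nn_integral_add) (auto simp: nn_integral_cmult_indicator)
  also have "(\<integral>\<^sup>+ z. emeasure lborel (I z) \<partial>lborel) = emeasure lborel D"
    using emeasure_by_lines[of D \<theta>] D(1) by (simp add: I_def)
  finally show ?thesis .
qed

text \<open>In the position \<open>Q\<close> of the motion this is a right translation of the Heisenberg group, and the
  group is unimodular.\<close>
lemma lborel_distr_motion: "distr lborel borel (\<lambda>Q. motion Q \<phi> p) = lborel"
proof -
  define w where "w = motion_linear 0 \<phi> p"
  define h where "h P = P - vector [w$1, w$2, w$3 + P$2 * w$1 - P$1 * w$2]" for P :: "real^3"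
  define h' where "h' P v = v - vector [0, 0, v$2 * w$1 - v$1 * w$2]" for P v :: "real^3"
  have motion: "motion Q \<phi> p = Q + vector [w$1, w$2, w$3 + Q$2 * w$1 - Q$1 * w$2]" for Q
    by (simp add: motion_def motion_linear_def w_def)
  show ?thesis
    unfolding motion
  proof (rule lborel_distr_unimodular[where h = h])
    show "h (x + vector [w$1, w$2, w$3 + x$2 * w$1 - x$1 * w$2]) = x" for x
      by (simp add: h_def vec_eq_iff forall_3 algebra_simps)
    show "h y + vector [w$1, w$2, w$3 + h y $2 * w$1 - h y $1 * w$2] = y" for y
      by (simp add: h_def vec_eq_iff forall_3 algebra_simps)
    show "continuous_on UNIV (\<lambda>x::real^3. x + vector [w$1, w$2, w$3 + x$2 * w$1 - x$1 * w$2])"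
      by (intro continuous_intros)
    show "(h has_derivative h' y) (at y)" for y
      unfolding has_derivative_componentwise_within[of h] Basis_vec_def
      by (auto simp: inner_axis forall_3 h_def h'_def
          intro!: derivative_eq_intros bounded_linear.has_derivative[OF bounded_linear_vec_nth])
    show "\<bar>det (matrix (h' y))\<bar> = 1" for y
      by (simp add: det_3 matrix_def h'_def axis_def)
  qed
qed

text \<open>Rotating both plane vectors \<open>(a, b)\<close> and \<open>(c', s')\<close> by one angle preserves their determinant;
  with \<open>s\<^sup>2 + c\<^sup>2\<close> kept as a factor this is an identity of polynomials.\<close>
lemma rotation_invariance:
  fixes a b c s c' s' :: real
  shows "(s * a + c * b) * (c * c' - s * s') - (c * a - s * b) * (s * c' + c * s') =
    (b * c' - a * s') * (s\<^sup>2 + c\<^sup>2)"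
  unfolding power2_eq_square by algebra

lemma motion_horizontal_segment:
  "motion Q \<phi> (p + s *\<^sub>R horizontal_direction \<theta> p) =
     motion Q \<phi> p + s *\<^sub>R horizontal_direction (\<phi> + \<theta>) (motion Q \<phi> p)"
proof -
  define P where "P = motion Q \<phi> p"
  have P: "P$1 = Q$1 + (cos \<phi> * p$1 - sin \<phi> * p$2)" "P$2 = Q$2 + (sin \<phi> * p$1 + cos \<phi> * p$2)"
    by (simp_all add: P_def motion_def motion_linear_def)
  have "(P$2 - Q$2) * cos (\<phi> + \<theta>) - (P$1 - Q$1) * sin (\<phi> + \<theta>) =
      (p$2 * cos \<theta> - p$1 * sin \<theta>) * ((sin \<phi>)\<^sup>2 + (cos \<phi>)\<^sup>2)"
    unfolding P cos_add sin_add add_diff_cancel_left' by (rule rotation_invariance)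
  then have rot: "p$2 * cos \<theta> - p$1 * sin \<theta> =
      (P$2 - Q$2) * cos (\<phi> + \<theta>) - (P$1 - Q$1) * sin (\<phi> + \<theta>)"
    unfolding sin_cos_squared_add mult_1_right by (rule sym)
  have "motion_linear Q \<phi> (horizontal_direction \<theta> p) = horizontal_direction (\<phi> + \<theta>) P"
    unfolding motion_linear_def horizontal_direction_def vec_eq_iff forall_3 vector_3 rot
      cos_add[symmetric] sin_add[symmetric] by (simp add: algebra_simps)
  then show ?thesis
    by (simp add: motion_def P_def linear_add[OF linear_motion_linear]
        linear_cmul[OF linear_motion_linear])
qed

lemma segment_meets_iff:
  assumes "0 \<le> l" "q = p + l *\<^sub>R horizontal_direction \<theta> p"
  shows "motion Q \<phi> ` path_image (linepath p q) \<inter> D \<noteq> {} \<longleftrightarrow>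
    (\<exists>s\<in>{0..l}. motion Q \<phi> p + s *\<^sub>R horizontal_direction (\<phi> + \<theta>) (motion Q \<phi> p) \<in> D)"
proof -
  have seg: "path_image (linepath p q) = (\<lambda>s. p + s *\<^sub>R horizontal_direction \<theta> p) ` {0..l}"
  proof (intro equalityI subsetI)
    fix x
    assume "x \<in> path_image (linepath p q)"
    then obtain u where "0 \<le> u" "u \<le> 1" "x = p + (u * l) *\<^sub>R horizontal_direction \<theta> p"
      by (auto simp: path_image_linepath in_segment assms(2) algebra_simps)
    then show "x \<in> (\<lambda>s. p + s *\<^sub>R horizontal_direction \<theta> p) ` {0..l}"
      using assms(1) by (auto simp: mult_left_le_one_le)
  next
    fix x
    assume "x \<in> (\<lambda>s. p + s *\<^sub>R horizontal_direction \<theta> p) ` {0..l}"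
    then obtain s where s: "0 \<le> s" "s \<le> l" "x = p + s *\<^sub>R horizontal_direction \<theta> p"
      by auto
    \<comment> \<open>for \<open>l = 0\<close> the segment is a point and every parameter works\<close>
    define u where "u = (if l = 0 then 0 else s / l)"
    have "0 \<le> u" "u \<le> 1" "s = u * l"
      using s assms(1) by (auto simp: u_def)
    then show "x \<in> path_image (linepath p q)"
      unfolding path_image_linepath in_segment assms(2) s(3)
      by (intro exI[of _ u]) (simp add: algebra_simps)
  qed
  show ?thesis
    unfolding seg image_image motion_horizontal_segment by auto
qed

lemma emeasure_motions_fixed_angle:
  assumes "open D" "bounded D" "convex D" "0 \<le> l" "q = p + l *\<^sub>R horizontal_direction \<theta> p"
  shows "emeasure lborel {Q. motion Q \<phi> ` path_image (linepath p q) \<inter> D \<noteq> {}} =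
    emeasure lborel D + ennreal l * emeasure lborel (shadow (\<phi> + \<theta>) ` D)"
proof -
  let ?G = "{P. \<exists>s\<in>{0..l}. P + s *\<^sub>R horizontal_direction (\<phi> + \<theta>) P \<in> D}"
  have meas: "(\<lambda>Q. motion Q \<phi> p) \<in> borel_measurable lborel"
    unfolding motion_def motion_linear_def
    by (simp, intro borel_measurable_continuous_onI continuous_intros)
  have "{Q. motion Q \<phi> ` path_image (linepath p q) \<inter> D \<noteq> {}} = (\<lambda>Q. motion Q \<phi> p) -` ?G"
    unfolding segment_meets_iff[OF assms(4,5)] by auto
  then have "emeasure lborel {Q. motion Q \<phi> ` path_image (linepath p q) \<inter> D \<noteq> {}} =
      emeasure (distr lborel borel (\<lambda>Q. motion Q \<phi> p)) ?G"
    using emeasure_distr[OF meas, of ?G] open_swept[OF assms(1), of l "\<phi> + \<theta>"] by simp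
  then show ?thesis
    unfolding lborel_distr_motion using emeasure_swept[OF assms(1-4)] by simp
qed


section \<open>The shadow map on the boundary\<close>

text \<open>The determinants \<open>det (u, v, e\<^sub>1)\<close> and \<open>det (u, v, e\<^sub>2)\<close> for the standard horizontal frame
  at \<open>P\<close>; both vanish exactly when the plane of \<open>u, v\<close> is the contact plane or \<open>u, v\<close> are dependent.\<close>

definition wedge1 :: "real^3 \<Rightarrow> real^3 \<Rightarrow> real^3 \<Rightarrow> real" where
  "wedge1 P u v = u$2 * v$3 - u$3 * v$2 + P$2 * (u$1 * v$2 - u$2 * v$1)"

definition wedge2 :: "real^3 \<Rightarrow> real^3 \<Rightarrow> real^3 \<Rightarrow> real" where
  "wedge2 P u v = u$3 * v$1 - u$1 * v$3 - P$1 * (u$1 * v$2 - u$2 * v$1)"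

definition shadow_jacobian :: "real \<Rightarrow> real^3 \<Rightarrow> real^3 \<Rightarrow> real^3 \<Rightarrow> real" where
  "shadow_jacobian \<theta> P u v = cos \<theta> * wedge1 P u v + sin \<theta> * wedge2 P u v"

definition shadow_derivative :: "real \<Rightarrow> real^3 \<Rightarrow> real^3 \<Rightarrow> real^2" where
  "shadow_derivative \<theta> P v = vector [v$2 * cos \<theta> - v$1 * sin \<theta>,
     v$3 - ((P$1 * cos \<theta> + P$2 * sin \<theta>) * (v$2 * cos \<theta> - v$1 * sin \<theta>)
       + (v$1 * cos \<theta> + v$2 * sin \<theta>) * (P$2 * cos \<theta> - P$1 * sin \<theta>))]"

lemma shadow_has_derivative: "(shadow \<theta> has_derivative shadow_derivative \<theta> P) (at P)"
  unfolding has_derivative_componentwise_within[of "shadow \<theta>"] Basis_vec_def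
  by (auto simp: inner_axis forall_2 shadow_def shadow_derivative_def
      intro!: derivative_eq_intros bounded_linear.has_derivative[OF bounded_linear_vec_nth])

lemma det_2_shadow:
  fixes c s p1 p2 u1 u2 u3 v1 v2 v3 :: real
  assumes "s\<^sup>2 + c\<^sup>2 = 1"
  shows "(u2 * c - u1 * s) * (v3 - ((p1 * c + p2 * s) * (v2 * c - v1 * s) + (v1 * c + v2 * s) * (p2 * c - p1 * s)))
    - (v2 * c - v1 * s) * (u3 - ((p1 * c + p2 * s) * (u2 * c - u1 * s) + (u1 * c + u2 * s) * (p2 * c - p1 * s)))
    = c * (u2 * v3 - u3 * v2 + p2 * (u1 * v2 - u2 * v1)) + s * (u3 * v1 - u1 * v3 - p1 * (u1 * v2 - u2 * v1))"
proof -
  have "(u2 * c - u1 * s) * (v3 - ((p1 * c + p2 * s) * (v2 * c - v1 * s) + (v1 * c + v2 * s) * (p2 * c - p1 * s)))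
    - (v2 * c - v1 * s) * (u3 - ((p1 * c + p2 * s) * (u2 * c - u1 * s) + (u1 * c + u2 * s) * (p2 * c - p1 * s)))
    = c * (u2 * v3 - u3 * v2) + s * (u3 * v1 - u1 * v3) + (p2 * c - p1 * s) * (u1 * v2 - u2 * v1) * (s\<^sup>2 + c\<^sup>2)"
    unfolding power2_eq_square by algebra
  then show ?thesis
    unfolding assms by algebra
qed

text \<open>Both sides are the determinant of \<open>u, v\<close> and the direction field: the coordinate change
  \<open>P \<mapsto> (\<sigma>, shadow \<theta> P)\<close> has determinant 1 and maps the field to the first unit vector.\<close>
lemma det_shadow_derivative:
  fixes A :: "real^2 \<Rightarrow> real^3"
  shows "det (matrix (\<lambda>w. shadow_derivative \<theta> P (A w))) =
    shadow_jacobian \<theta> P (A (axis 1 1)) (A (axis 2 1))"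
  using det_2_shadow[OF sin_cos_squared_add]
  by (simp only: det_2 matrix_def shadow_derivative_def vec_lambda_beta vector_2
      shadow_jacobian_def wedge1_def wedge2_def)

text \<open>The boundary points at which the line in direction \<open>\<theta>\<close> enters \<open>D\<close> (\<open>\<epsilon> = 1\<close>) or leaves it
  (\<open>\<epsilon> = -1\<close>).\<close>
definition boundary_side :: "real \<Rightarrow> real \<Rightarrow> (real^3) set \<Rightarrow> (real^3) set" where
  "boundary_side \<theta> \<epsilon> D =
     {q \<in> frontier D. \<exists>s>0. q + (\<epsilon> * s) *\<^sub>R horizontal_direction \<theta> q \<in> D}"

lemma convex_open_ray:
  fixes q v :: "'a::euclidean_space"
  assumes "open D" "convex D" "q \<in> closure D" "q + t *\<^sub>R v \<in> D" "0 < r" "r \<le> t"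
  shows "q + r *\<^sub>R v \<in> D"
proof -
  let ?x = "q + t *\<^sub>R v"
  have "q - (r / t) *\<^sub>R (q - ?x) \<in> interior D"
    using assms by (intro mem_interior_closure_convex_shrink) (auto simp: interior_open)
  moreover have "q - (r / t) *\<^sub>R (q - ?x) = q + r *\<^sub>R v"
    using assms(5,6) by simp
  ultimately have "q + r *\<^sub>R v \<in> interior D"
    by (simp only:)
  then show ?thesis
    using assms(1) by (simp add: interior_open)
qed

lemma frontier_open_disjoint: "open D \<Longrightarrow> q \<in> frontier D \<Longrightarrow> q \<in> closure D \<and> q \<notin> D"
  by (simp add: frontier_def interior_open)

text \<open>If a line entered \<open>D\<close> at two points, the later one would lie strictly between the earlier one and
  a point of \<open>D\<close>, hence in \<open>D\<close> rather than on its boundary.\<close>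
lemma shadow_inj_on_boundary_side:
  assumes "open D" "convex D" "\<epsilon> \<in> {1, -1}"
  shows "inj_on (shadow \<theta>) (boundary_side \<theta> \<epsilon> D)"
proof (rule inj_onI)
  have no_two: False
    if q: "q \<in> boundary_side \<theta> \<epsilon> D" "q + (\<epsilon> * r) *\<^sub>R horizontal_direction \<theta> q \<in> boundary_side \<theta> \<epsilon> D"
      and "0 < r" for q r
  proof -
    let ?v = "\<epsilon> *\<^sub>R horizontal_direction \<theta> q" and ?q = "q + (\<epsilon> * r) *\<^sub>R horizontal_direction \<theta> q"
    have q': "q \<in> closure D" and q'': "?q \<notin> D"
      using q frontier_open_disjoint[OF assms(1)] unfolding boundary_side_def by blast+
    obtain s where s: "0 < s" "?q + (\<epsilon> * s) *\<^sub>R horizontal_direction \<theta> ?q \<in> D"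
      using q(2) by (auto simp: boundary_side_def)
    then have "q + (r + s) *\<^sub>R ?v \<in> D"
      by (simp add: algebra_simps)
    from convex_open_ray[OF assms(1,2) q' this \<open>0 < r\<close>] have "q + r *\<^sub>R ?v \<in> D"
      using s(1) by simp
    moreover have "r *\<^sub>R ?v = (\<epsilon> * r) *\<^sub>R horizontal_direction \<theta> q"
      by (simp add: mult.commute)
    ultimately show False
      using q'' by (simp only:)
  qed
  fix q q'
  assume q: "q \<in> boundary_side \<theta> \<epsilon> D" "q' \<in> boundary_side \<theta> \<epsilon> D" "shadow \<theta> q = shadow \<theta> q'"
  obtain r where r: "q' = q + r *\<^sub>R horizontal_direction \<theta> q"
    using shadow_eq_imp_same_line[OF q(3)] .
  have \<epsilon>: "\<epsilon> * (\<epsilon> * r) = r"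
    using assms(3) by auto
  have dir: "horizontal_direction \<theta> q' = horizontal_direction \<theta> q"
    by (simp add: r)
  consider "\<epsilon> * r > 0" | "r = 0" | "\<epsilon> * r < 0"
    using assms(3) linorder_less_linear[of r 0] by fastforce
  then show "q = q'"
  proof cases
    case 1
    then show ?thesis
      using no_two[of q "\<epsilon> * r"] q r \<epsilon> by simp
  next
    case 2
    then show ?thesis
      by (simp add: r)
  next
    case 3
    have "q = q' + (\<epsilon> * (- (\<epsilon> * r))) *\<^sub>R horizontal_direction \<theta> q'"
      unfolding dir by (simp add: r \<epsilon>)
    then show ?thesis
      using no_two[of q' "- (\<epsilon> * r)"] q 3 by simp
  qed
qed

lemma norm_horizontal_direction_ge_1: "1 \<le> norm (horizontal_direction \<theta> P)"
proof -
  have "(cos \<theta>)\<^sup>2 + (sin \<theta>)\<^sup>2 \<le> (norm (horizontal_direction \<theta> P))\<^sup>2"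
    by (simp add: norm_vec_def L2_set_def sum_3 horizontal_direction_def sum_nonneg)
  then have "1\<^sup>2 \<le> (norm (horizontal_direction \<theta> P))\<^sup>2"
    by simp
  then show ?thesis
    by (rule power2_le_imp_le) simp
qed

text \<open>Starting in \<open>D\<close> and moving backwards along the line, the boundary is reached because \<open>D\<close> is
  bounded and the direction field has norm at least 1.\<close>
lemma shadow_boundary_side:
  assumes "open D" "bounded D" "\<epsilon> \<in> {1, -1}"
  shows "shadow \<theta> ` boundary_side \<theta> \<epsilon> D = shadow \<theta> ` D"
proof (intro equalityI subsetI)
  fix z
  assume "z \<in> shadow \<theta> ` boundary_side \<theta> \<epsilon> D"
  then obtain q s where "z = shadow \<theta> q" "q + (\<epsilon> * s) *\<^sub>R horizontal_direction \<theta> q \<in> D"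
    by (auto simp: boundary_side_def)
  then show "z \<in> shadow \<theta> ` D"
    by (intro image_eqI[of _ _ "q + (\<epsilon> * s) *\<^sub>R horizontal_direction \<theta> q"]) simp_all
next
  fix z
  assume "z \<in> shadow \<theta> ` D"
  then obtain P where P: "P \<in> D" "z = shadow \<theta> P"
    by blast
  define v where "v = horizontal_direction \<theta> P"
  obtain b where b: "0 < b" "\<And>x. x \<in> D \<Longrightarrow> norm x \<le> b"
    using assms(2) bounded_pos by blast
  \<comment> \<open>\<open>2 b + 1\<close> exceeds the distance between any two points of \<open>D\<close>\<close>
  define R where "R = (\<lambda>r. P + (- \<epsilon> * r) *\<^sub>R v) ` {0..2 * b + 1}"
  have "connected R"
    unfolding R_def by (intro connected_continuous_image continuous_intros) simp
  moreover have "R \<inter> D \<noteq> {}"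
  proof -
    have "P \<in> R"
      unfolding R_def using b(1) by (intro image_eqI[of _ _ 0]) auto
    then show ?thesis
      using P(1) by blast
  qed
  moreover have "R - D \<noteq> {}"
  proof -
    let ?x = "P + (- \<epsilon> * (2 * b + 1)) *\<^sub>R v"
    have "norm ((- \<epsilon> * (2 * b + 1)) *\<^sub>R v) = (2 * b + 1) * norm v"
      using assms(3) b(1) by auto
    also have "\<dots> \<ge> (2 * b + 1) * 1"
      using b(1) norm_horizontal_direction_ge_1 unfolding v_def by (intro mult_left_mono) auto
    finally have "2 * b + 1 \<le> norm (?x - P)"
      by simp
    also have "\<dots> \<le> norm ?x + norm P"
      by (rule norm_triangle_ineq4)
    finally have "?x \<notin> D"
      using b(2)[of ?x] b(2)[OF P(1)] by auto
    moreover have "?x \<in> R"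
      unfolding R_def using b(1) by (intro image_eqI[of _ _ "2 * b + 1"]) auto
    ultimately show ?thesis
      by blast
  qed
  ultimately have "R \<inter> frontier D \<noteq> {}"
    by (rule connected_Int_frontier)
  then obtain r where r: "0 \<le> r" "P + (- \<epsilon> * r) *\<^sub>R v \<in> frontier D"
    by (auto simp: R_def)
  define q where "q = P + (- \<epsilon> * r) *\<^sub>R v"
  have "r \<noteq> 0"
    using r(2) P(1) frontier_open_disjoint[OF assms(1)] by auto
  moreover have dir: "horizontal_direction \<theta> q = v"
    by (simp only: q_def v_def horizontal_direction_along_line)
  moreover have "q + (\<epsilon> * r) *\<^sub>R v = P"
    by (simp add: q_def)
  ultimately have "q \<in> boundary_side \<theta> \<epsilon> D"
    using r P(1) unfolding boundary_side_def q_def[symmetric]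
    by (auto intro!: exI[of _ r])
  moreover have "shadow \<theta> q = z"
    by (simp only: q_def v_def shadow_along_line P(2))
  ultimately show "z \<in> shadow \<theta> ` boundary_side \<theta> \<epsilon> D"
    by blast
qed

lemma boundary_sides_disjoint:
  assumes "open D" "convex D"
  shows "boundary_side \<theta> 1 D \<inter> boundary_side \<theta> (-1) D = {}"
proof -
  have False if q: "q \<in> boundary_side \<theta> 1 D" "q \<in> boundary_side \<theta> (-1) D" for q
  proof -
    let ?v = "horizontal_direction \<theta> q"
    obtain s t where st: "0 < s" "0 < t" "q + s *\<^sub>R ?v \<in> D" "q - t *\<^sub>R ?v \<in> D" "q \<in> frontier D"
      using q by (auto simp: boundary_side_def)
    have "(t / (s + t)) *\<^sub>R (q + s *\<^sub>R ?v) + (s / (s + t)) *\<^sub>R (q - t *\<^sub>R ?v) \<in> D"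
      using st by (intro convexD[OF assms(2)]) (auto simp: add_divide_distrib[symmetric])
    also have "(t / (s + t)) *\<^sub>R (q + s *\<^sub>R ?v) + (s / (s + t)) *\<^sub>R (q - t *\<^sub>R ?v) =
        (t / (s + t) + s / (s + t)) *\<^sub>R q"
      by (simp add: algebra_simps)
    also have "t / (s + t) + s / (s + t) = 1"
      using st by (simp add: add_divide_distrib[symmetric])
    finally show False
      using frontier_open_disjoint[OF assms(1) st(5)] by simp
  qed
  then show ?thesis
    by blast
qed

text \<open>Cramer's rule: each component of \<open>a\<close> times the determinant is a combination of the three
  linear forms.\<close>
lemma coplanar_imp_det_zero:
  fixes a1 a2 a3 u1 u2 u3 v1 v2 v3 w1 w2 w3 :: real
  assumes "a1 * u1 + a2 * u2 + a3 * u3 = 0" "a1 * v1 + a2 * v2 + a3 * v3 = 0"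
    "a1 * w1 + a2 * w2 + a3 * w3 = 0" "a1 \<noteq> 0 \<or> a2 \<noteq> 0 \<or> a3 \<noteq> 0"
  shows "w1 * (u2 * v3 - u3 * v2) + w2 * (u3 * v1 - u1 * v3) + w3 * (u1 * v2 - u2 * v1) = 0"
proof -
  let ?d = "w1 * (u2 * v3 - u3 * v2) + w2 * (u3 * v1 - u1 * v3) + w3 * (u1 * v2 - u2 * v1)"
  let ?U = "a1 * u1 + a2 * u2 + a3 * u3" and ?V = "a1 * v1 + a2 * v2 + a3 * v3"
    and ?W = "a1 * w1 + a2 * w2 + a3 * w3"
  have "a1 * ?d = ?U * (v2 * w3 - v3 * w2) + ?V * (w2 * u3 - w3 * u2) + ?W * (u2 * v3 - u3 * v2)"
    "a2 * ?d = ?U * (v3 * w1 - v1 * w3) + ?V * (w3 * u1 - w1 * u3) + ?W * (u3 * v1 - u1 * v3)"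
    "a3 * ?d = ?U * (v1 * w2 - v2 * w1) + ?V * (w1 * u2 - w2 * u1) + ?W * (u1 * v2 - u2 * v1)"
    by algebra+
  then have "a1 * ?d = 0" "a2 * ?d = 0" "a3 * ?d = 0"
    unfolding assms(1-3) by simp_all
  then show ?thesis
    using assms(4) by auto
qed

lemma shadow_jacobian_eq_det:
  "shadow_jacobian \<theta> P u v =
    horizontal_direction \<theta> P $ 1 * (u$2 * v$3 - u$3 * v$2) +
    horizontal_direction \<theta> P $ 2 * (u$3 * v$1 - u$1 * v$3) +
    horizontal_direction \<theta> P $ 3 * (u$1 * v$2 - u$2 * v$1)"
  by (simp add: shadow_jacobian_def wedge1_def wedge2_def horizontal_direction_def algebra_simps)

lemma bounded_linear_form_imp_zero:
  fixes a b c :: real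
  assumes "\<And>r. b \<le> c + r * a"
  shows "a = 0"
proof (rule ccontr)
  assume "a \<noteq> 0"
  then show False
    using assms[of "(b - c - 1) / a"] by simp
qed

text \<open>If the line through a boundary point misses \<open>D\<close>, a plane separates it from \<open>D\<close>, and this plane
  must contain the line. Its linear form is maximal on the boundary at that point, so its derivative
  along the surface vanishes there; the tangent plane and the line are then annihilated by
  one nonzero linear form.\<close>
lemma shadow_jacobian_zero_off_sides:
  assumes D: "open D" "convex D" "D \<noteq> {}"
    and X: "open U" "X ` U \<subseteq> frontier D" "u \<in> U" "(X has_derivative X') (at u)"
    and off: "X u \<notin> boundary_side \<theta> 1 D" "X u \<notin> boundary_side \<theta> (-1) D"
  shows "shadow_jacobian \<theta> (X u) (X' e) (X' f) = 0"
proof -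
  let ?q = "X u" and ?v = "horizontal_direction \<theta> (X u)"
  define L where "L = range (\<lambda>r. ?q + r *\<^sub>R ?v)"
  have q: "?q \<in> frontier D"
    using X by blast
  have miss: "?q + r *\<^sub>R ?v \<notin> D" for r
  proof
    assume *: "?q + r *\<^sub>R ?v \<in> D"
    consider "r = 0" | "r > 0" | "- r > 0"
      by linarith
    then show False
    proof cases
      case 1
      then show False
        using * q frontier_open_disjoint[OF D(1)] by simp
    next
      case 2
      then have "?q \<in> boundary_side \<theta> 1 D"
        using * q unfolding boundary_side_def by (intro CollectI conjI exI[of _ r]) simp_all
      then show False
        using off(1) by contradiction
    next
      case 3
      then have "?q \<in> boundary_side \<theta> (-1) D"
        using * q unfolding boundary_side_def by (intro CollectI conjI exI[of _ "- r"]) simp_all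
      then show False
        using off(2) by contradiction
    qed
  qed
  have "convex L"
  proof (rule convexI)
    fix x y :: "real^3" and \<alpha> \<beta> :: real
    assume "x \<in> L" "y \<in> L" and uv: "0 \<le> \<alpha>" "0 \<le> \<beta>" "\<alpha> + \<beta> = 1"
    then obtain r r' where "x = ?q + r *\<^sub>R ?v" "y = ?q + r' *\<^sub>R ?v"
      by (auto simp: L_def)
    then have "\<alpha> *\<^sub>R x + \<beta> *\<^sub>R y = (\<alpha> + \<beta>) *\<^sub>R ?q + (\<alpha> * r + \<beta> * r') *\<^sub>R ?v"
      by (simp add: algebra_simps)
    then have "\<alpha> *\<^sub>R x + \<beta> *\<^sub>R y = ?q + (\<alpha> * r + \<beta> * r') *\<^sub>R ?v"
      unfolding uv(3) by simp
    then show "\<alpha> *\<^sub>R x + \<beta> *\<^sub>R y \<in> L"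
      unfolding L_def by (rule range_eqI)
  qed
  moreover have "D \<inter> L = {}" "L \<noteq> {}"
    using miss by (auto simp: L_def)
  ultimately obtain a b where ab: "a \<noteq> 0" "\<And>x. x \<in> D \<Longrightarrow> a \<bullet> x \<le> b" "\<And>x. x \<in> L \<Longrightarrow> b \<le> a \<bullet> x"
    using separating_hyperplane_sets[of D L] D by metis
  have "b \<le> a \<bullet> ?q + r * (a \<bullet> ?v)" for r
  proof -
    have "?q + r *\<^sub>R ?v \<in> L"
      unfolding L_def by (rule rangeI)
    then show ?thesis
      using ab(3) by (fastforce simp: inner_add_right)
  qed
  then have v: "a \<bullet> ?v = 0" and "b \<le> a \<bullet> ?q"
    using bounded_linear_form_imp_zero[of b "a \<bullet> ?q" "a \<bullet> ?v"] by (blast, metis add_0_right mult_zero_left)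
  have "a \<bullet> x \<le> b" if x: "x \<in> closure D" for x
  proof -
    have "closure D \<subseteq> {x. a \<bullet> x \<le> b}"
      using ab(2) by (intro closure_minimal closed_halfspace_le) auto
    then show ?thesis
      using x by blast
  qed
  then have "a \<bullet> X y \<le> a \<bullet> ?q" if y: "y \<in> U" for y
    using X(2) y \<open>b \<le> a \<bullet> ?q\<close> frontier_open_disjoint[OF D(1), of "X y"] by fastforce
  moreover have "((\<lambda>y. a \<bullet> X y) has_derivative (\<lambda>w. a \<bullet> X' w)) (at u)"
    using X(4) by (rule has_derivative_inner_right)
  ultimately have "(\<lambda>w. a \<bullet> X' w) = (\<lambda>w. 0)"
    using X(1,3) by (intro differential_zero_maxmin[of u U "\<lambda>y. a \<bullet> X y"]) auto
  then have "a \<bullet> X' w = 0" for w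
    by meson
  then show ?thesis
    unfolding shadow_jacobian_eq_det
    using v ab(1) by (intro coplanar_imp_det_zero[of "a$1" _ "a$2" _ "a$3"])
      (auto simp: inner_vec_def sum_3 vec_eq_iff forall_3)
qed

text \<open>The change of variables formula for nonnegative integrals. Boundedness of the image makes both
  sides finite.\<close>
lemma nn_integral_abs_det_eq_emeasure_image:
  fixes g :: "real^'n::{finite,wellorder} \<Rightarrow> real^'n::_"
  assumes "S \<in> sets borel" "inj_on g S" "bounded (g ` S)"
    and der: "\<And>x. x \<in> S \<Longrightarrow> (g has_derivative g' x) (at x)"
  shows "(\<integral>\<^sup>+ x \<in> S. ennreal \<bar>det (matrix (g' x))\<bar> \<partial>lborel) = emeasure lebesgue (g ` S)"
    and "g ` S \<in> sets lebesgue"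
proof -
  have S: "S \<in> sets lebesgue"
    using assms(1) by simp
  have der': "(g has_derivative g' x) (at x within S)" if "x \<in> S" for x
    using der[OF that] by (rule has_derivative_at_withinI)
  show "g ` S \<in> sets lebesgue"
    using S der' by (intro differentiable_image_in_sets_lebesgue)
      (auto simp: differentiable_on_def differentiable_def)
  then have meas: "g ` S \<in> lmeasurable"
    using assms(3) by (rule bounded_set_imp_lmeasurable[rotated])
  then have "((\<lambda>x. \<bar>det (matrix (g' x))\<bar>) has_integral measure lebesgue (g ` S)) S"
    using has_measure_differentiable_image[OF S der' assms(2), of "measure lebesgue (g ` S)"] by blast
  then have "(\<integral>\<^sup>+ x \<in> S. ennreal \<bar>det (matrix (g' x))\<bar> \<partial>lborel) = ennreal (measure lebesgue (g ` S))"
    by (intro nn_integral_has_integral_lebesgue') auto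
  then show "(\<integral>\<^sup>+ x \<in> S. ennreal \<bar>det (matrix (g' x))\<bar> \<partial>lborel) = emeasure lebesgue (g ` S)"
    using emeasure_eq_measure2[OF meas] by simp
qed

lemma bounded_shadow:
  assumes "bounded D"
  shows "bounded (shadow \<theta> ` D)"
proof -
  have "continuous_on (closure D) (shadow \<theta>)"
    using shadow_has_derivative has_derivative_at_withinI has_derivative_continuous_on by metis
  then have "bounded (shadow \<theta> ` closure D)"
    using assms by (simp add: compact_imp_bounded compact_continuous_image)
  then show ?thesis
    by (rule bounded_subset) (intro image_mono closure_subset)
qed

lemma surface_chartD:
  assumes "surface_chart S U X"
  shows "open U" "X ` U \<subseteq> S" "inj_on X U" "continuous_on U X"
    "\<And>u. u \<in> U \<Longrightarrow> (X has_derivative frechet_derivative X (at u)) (at u)"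
    "\<And>v. continuous_on U (\<lambda>u. frechet_derivative X (at u) v)"
proof -
  have smooth: "smooth_on U X"
    using assms by (simp add: surface_chart_def)
  obtain g where g: "homeomorphism U (X ` U) X g"
    using assms by (auto simp: surface_chart_def)
  show "open U"
    using assms by (simp add: surface_chart_def)
  show "X ` U \<subseteq> S"
    using assms unfolding surface_chart_def by (elim conjE) (rule openin_imp_subset)
  show "inj_on X U"
    using homeomorphism_apply1[OF g] by (rule inj_on_inverseI)
  show "continuous_on U X"
    using smooth by (rule smooth_on_continuous_on)
  show "(X has_derivative frechet_derivative X (at u)) (at u)" if "u \<in> U" for u
    using smooth that by (rule smooth_on_has_derivative)
  show "continuous_on U (\<lambda>u. frechet_derivative X (at u) v)" for v
    using smooth by (intro smooth_on_continuous_on smooth_on_frechet_derivative)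
qed

lemma boundary_side_preimage_borel:
  assumes "open D" "surface_chart (frontier D) U X" "B \<in> sets borel" "B \<subseteq> U"
  shows "{u \<in> B. X u \<in> boundary_side \<theta> \<epsilon> D} \<in> sets borel"
proof -
  let ?O = "\<Union>s\<in>{0<..}. (\<lambda>q. q + (\<epsilon> * s) *\<^sub>R horizontal_direction \<theta> q) -` D"
  have "open ?O"
    by (intro open_UN ballI open_vimage assms(1) continuous_intros)
  then have "open (U \<inter> X -` ?O)"
    using surface_chartD[OF assms(2)] by (intro continuous_open_preimage)
  moreover have "{u \<in> B. X u \<in> boundary_side \<theta> \<epsilon> D} = B \<inter> (U \<inter> X -` ?O)"
    using assms(4) surface_chartD(2)[OF assms(2)] unfolding boundary_side_def by blast
  ultimately show ?thesis
    using assms(3) by simp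
qed

lemma wedge_measurable:
  assumes "surface_chart S U X" "B \<in> sets borel" "B \<subseteq> U"
  shows "(\<lambda>u. indicator B u * wedge1 (X u) (frechet_derivative X (at u) v) (frechet_derivative X (at u) w))
      \<in> borel_measurable borel"
    and "(\<lambda>u. indicator B u * wedge2 (X u) (frechet_derivative X (at u) v) (frechet_derivative X (at u) w))
      \<in> borel_measurable borel"
proof -
  note X = surface_chartD(4,6)[OF assms(1)]
  have "continuous_on U (\<lambda>u. wedge1 (X u) (frechet_derivative X (at u) v) (frechet_derivative X (at u) w))"
    "continuous_on U (\<lambda>u. wedge2 (X u) (frechet_derivative X (at u) v) (frechet_derivative X (at u) w))"
    unfolding wedge1_def wedge2_def by (intro continuous_intros X)+
  then have "continuous_on B (\<lambda>u. wedge1 (X u) (frechet_derivative X (at u) v) (frechet_derivative X (at u) w))"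
    "continuous_on B (\<lambda>u. wedge2 (X u) (frechet_derivative X (at u) v) (frechet_derivative X (at u) w))"
    using assms(3) continuous_on_subset by blast+
  from this[THEN borel_measurable_continuous_on_indicator[OF assms(2)]]
  show "(\<lambda>u. indicator B u * wedge1 (X u) (frechet_derivative X (at u) v) (frechet_derivative X (at u) w))
      \<in> borel_measurable borel"
    "(\<lambda>u. indicator B u * wedge2 (X u) (frechet_derivative X (at u) v) (frechet_derivative X (at u) w))
      \<in> borel_measurable borel"
    by simp_all
qed

abbreviation chart_jacobian :: "real \<Rightarrow> (real^2 \<Rightarrow> real^3) \<Rightarrow> real^2 \<Rightarrow> real" where
  "chart_jacobian \<theta> X u \<equiv> shadow_jacobian \<theta> (X u)
     (frechet_derivative X (at u) (axis 1 1)) (frechet_derivative X (at u) (axis 2 1))"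

text \<open>The shadow map is injective on each side and maps it onto the shadow of \<open>D\<close>, so the change of
  variables formula gives the areas of the disjoint pieces of the shadow.\<close>
lemma nn_integral_chart_jacobian_side:
  assumes D: "open D" "bounded D" "convex D"
    and dec: "chart_decomposition (frontier D) X B" and \<epsilon>: "\<epsilon> \<in> {1, -1}"
  shows "(\<Sum>i. \<integral>\<^sup>+ u \<in> {u \<in> B i. X i u \<in> boundary_side \<theta> \<epsilon> D}.
      ennreal \<bar>chart_jacobian \<theta> (X i) u\<bar> \<partial>lborel) = emeasure lborel (shadow \<theta> ` D)"
proof -
  define E where "E i = {u \<in> B i. X i u \<in> boundary_side \<theta> \<epsilon> D}" for i
  define A where "A i = (\<lambda>u. shadow \<theta> (X i u)) ` E i" for i
  have *: "(\<integral>\<^sup>+ u \<in> E i. ennreal \<bar>chart_jacobian \<theta> (X i) u\<bar> \<partial>lborel) = emeasure lebesgue (A i)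
      \<and> A i \<in> sets lebesgue" for i
  proof -
    obtain U where U: "surface_chart (frontier D) U (X i)" "B i \<subseteq> U" "B i \<in> sets borel"
      using dec unfolding chart_decomposition_def by blast
    have E: "E i \<in> sets borel"
      unfolding E_def by (rule boundary_side_preimage_borel[OF D(1) U(1,3,2)])
    have EU: "E i \<subseteq> U"
      using U(2) by (auto simp: E_def)
    have "X i ` E i \<subseteq> boundary_side \<theta> \<epsilon> D"
      by (auto simp: E_def)
    then have inj: "inj_on (\<lambda>u. shadow \<theta> (X i u)) (E i)"
      using comp_inj_on[OF inj_on_subset[OF surface_chartD(3)[OF U(1)] EU]
          inj_on_subset[OF shadow_inj_on_boundary_side[OF D(1,3) \<epsilon>, of \<theta>]]]
      by (simp add: comp_def)
    have "A i \<subseteq> shadow \<theta> ` D"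
      using shadow_boundary_side[OF D(1,2) \<epsilon>, of \<theta>] by (auto simp: A_def E_def)
    then have "bounded (A i)"
      using bounded_shadow[OF D(2)] bounded_subset by blast
    moreover have "((\<lambda>u. shadow \<theta> (X i u)) has_derivative
        (\<lambda>w. shadow_derivative \<theta> (X i u) (frechet_derivative (X i) (at u) w))) (at u)" if "u \<in> E i" for u
      using EU that surface_chartD(5)[OF U(1)] by (intro has_derivative_compose[OF _ shadow_has_derivative]) auto
    ultimately show ?thesis
      using nn_integral_abs_det_eq_emeasure_image[OF E inj, of "\<lambda>u w. shadow_derivative \<theta> (X i u)
          (frechet_derivative (X i) (at u) w)"]
      unfolding A_def[symmetric] det_shadow_derivative by simp
  qed
  have "disjoint_family A"
    unfolding disjoint_family_on_def
  proof (intro ballI impI)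
    fix i j :: nat
    assume "i \<noteq> j"
    then have "X i ` E i \<inter> X j ` E j = {}"
      using dec unfolding chart_decomposition_def disjoint_family_on_def E_def by blast
    moreover have "X i ` E i \<subseteq> boundary_side \<theta> \<epsilon> D" "X j ` E j \<subseteq> boundary_side \<theta> \<epsilon> D"
      by (auto simp: E_def)
    ultimately have "shadow \<theta> ` (X i ` E i) \<inter> shadow \<theta> ` (X j ` E j) = {}"
      using inj_on_image_Int[OF shadow_inj_on_boundary_side[OF D(1,3) \<epsilon>]] by (metis image_empty)
    then show "A i \<inter> A j = {}"
      by (simp add: A_def image_image)
  qed
  moreover have "(\<Union>i. A i) = shadow \<theta> ` D"
  proof -
    have "(\<Union>i. X i ` E i) = boundary_side \<theta> \<epsilon> D"
    proof
      have "boundary_side \<theta> \<epsilon> D \<subseteq> (\<Union>i. X i ` B i)"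
        using dec unfolding chart_decomposition_def boundary_side_def by blast
      then show "boundary_side \<theta> \<epsilon> D \<subseteq> (\<Union>i. X i ` E i)"
        unfolding E_def by blast
    qed (auto simp: E_def)
    then have "shadow \<theta> ` (\<Union>i. X i ` E i) = shadow \<theta> ` D"
      using shadow_boundary_side[OF D(1,2) \<epsilon>] by simp
    then show ?thesis
      by (simp add: A_def image_UN image_image)
  qed
  ultimately have "(\<Sum>i. emeasure lebesgue (A i)) = emeasure lebesgue (shadow \<theta> ` D)"
    using * suminf_emeasure[of A lebesgue] by auto
  moreover have "emeasure lebesgue (shadow \<theta> ` D) = emeasure lborel (shadow \<theta> ` D)"
    using open_shadow[OF D(1)] by simp
  ultimately show ?thesis
    using * by (simp add: E_def[symmetric])
qed

text \<open>Entrance and exit points contribute the area of the shadow once each.\<close>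
lemma nn_integral_chart_jacobian:
  assumes D: "open D" "bounded D" "convex D" "D \<noteq> {}"
    and dec: "chart_decomposition (frontier D) X B"
  shows "(\<Sum>i. \<integral>\<^sup>+ u \<in> B i. ennreal \<bar>chart_jacobian \<theta> (X i) u\<bar> \<partial>lborel) =
    2 * emeasure lborel (shadow \<theta> ` D)"
proof -
  define E where "E \<epsilon> i = {u \<in> B i. X i u \<in> boundary_side \<theta> \<epsilon> D}" for \<epsilon> i
  have "(\<integral>\<^sup>+ u \<in> B i. ennreal \<bar>chart_jacobian \<theta> (X i) u\<bar> \<partial>lborel) =
      (\<integral>\<^sup>+ u \<in> E 1 i. ennreal \<bar>chart_jacobian \<theta> (X i) u\<bar> \<partial>lborel) +
      (\<integral>\<^sup>+ u \<in> E (-1) i. ennreal \<bar>chart_jacobian \<theta> (X i) u\<bar> \<partial>lborel)" for i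
  proof -
    obtain U where U: "surface_chart (frontier D) U (X i)" "B i \<subseteq> U" "B i \<in> sets borel"
      using dec unfolding chart_decomposition_def by blast
    have meas: "(\<lambda>u. ennreal \<bar>chart_jacobian \<theta> (X i) u\<bar> * indicator (E \<epsilon> i) u) \<in> borel_measurable lborel" for \<epsilon>
    proof -
      have [measurable]: "E \<epsilon> i \<in> sets borel"
        unfolding E_def by (rule boundary_side_preimage_borel[OF D(1) U(1,3,2)])
      have EU: "E \<epsilon> i \<subseteq> U"
        using U(2) by (auto simp: E_def)
      note [measurable] = wedge_measurable[OF U(1) \<open>E \<epsilon> i \<in> sets borel\<close> EU, of "axis 1 1" "axis 2 1"]
      have "(\<lambda>u. ennreal \<bar>chart_jacobian \<theta> (X i) u\<bar> * indicator (E \<epsilon> i) u) =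
        (\<lambda>u. ennreal \<bar>cos \<theta> * (indicator (E \<epsilon> i) u * wedge1 (X i u) (frechet_derivative (X i) (at u) (axis 1 1))
              (frechet_derivative (X i) (at u) (axis 2 1))) +
            sin \<theta> * (indicator (E \<epsilon> i) u * wedge2 (X i u) (frechet_derivative (X i) (at u) (axis 1 1))
              (frechet_derivative (X i) (at u) (axis 2 1)))\<bar>)"
        by (simp add: fun_eq_iff indicator_def shadow_jacobian_def)
      then show ?thesis
        by simp
    qed
    have "ennreal \<bar>chart_jacobian \<theta> (X i) u\<bar> * indicator (B i) u =
        ennreal \<bar>chart_jacobian \<theta> (X i) u\<bar> * indicator (E 1 i) u +
        ennreal \<bar>chart_jacobian \<theta> (X i) u\<bar> * indicator (E (-1) i) u" for u
    proof (cases "u \<in> B i \<and> u \<notin> E 1 i \<and> u \<notin> E (-1) i")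
      case True
      then have "chart_jacobian \<theta> (X i) u = 0"
        using U surface_chartD[OF U(1)] unfolding E_def
        by (intro shadow_jacobian_zero_off_sides[OF D(1,3,4), of U]) auto
      then show ?thesis
        by simp
    next
      case False
      moreover have "u \<notin> E 1 i \<or> u \<notin> E (-1) i"
        using boundary_sides_disjoint[OF D(1,3), of \<theta>] unfolding E_def by blast
      moreover have "E \<epsilon> i \<subseteq> B i" for \<epsilon>
        by (auto simp: E_def)
      ultimately show ?thesis
        by (auto simp: indicator_def)
    qed
    then show ?thesis
      using meas by (simp add: nn_integral_add)
  qed
  then have "(\<Sum>i. \<integral>\<^sup>+ u \<in> B i. ennreal \<bar>chart_jacobian \<theta> (X i) u\<bar> \<partial>lborel) =
      (\<Sum>i. \<integral>\<^sup>+ u \<in> E 1 i. ennreal \<bar>chart_jacobian \<theta> (X i) u\<bar> \<partial>lborel) +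
      (\<Sum>i. \<integral>\<^sup>+ u \<in> E (-1) i. ennreal \<bar>chart_jacobian \<theta> (X i) u\<bar> \<partial>lborel)"
    by (simp add: suminf_add)
  also have "\<dots> = emeasure lborel (shadow \<theta> ` D) + emeasure lborel (shadow \<theta> ` D)"
    unfolding E_def using nn_integral_chart_jacobian_side[OF D(1-3) dec, of _ \<theta>] by simp
  finally show ?thesis
    by (simp add: mult_2)
qed


section \<open>The p-area density\<close>

lemma coframe1_eq:
  assumes "levi_norm e = 1"
  shows "coframe1 q e w = w$1 * e$1 + w$2 * e$2"
  unfolding coframe1_def
proof (rule the_equality)
  have e: "(e$1)\<^sup>2 + (e$2)\<^sup>2 = 1"
    using assms by (simp add: levi_norm_def)
  have Je: "J q e $ 1 = - e$2" "J q e $ 2 = e$1"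
    by (simp_all add: J_def frame1_def frame2_def)
  let ?a = "w$1 * e$1 + w$2 * e$2" and ?b = "w$2 * e$1 - w$1 * e$2"
  have "?a * e$1 - ?b * e$2 = w$1 * ((e$1)\<^sup>2 + (e$2)\<^sup>2)"
    "?a * e$2 + ?b * e$1 = w$2 * ((e$1)\<^sup>2 + (e$2)\<^sup>2)"
    unfolding power2_eq_square by algebra+
  then have "w = ?a *\<^sub>R e + ?b *\<^sub>R J q e + (w$3 - ?a * e$3 - ?b * J q e $ 3) *\<^sub>R frameT"
    unfolding e by (simp add: vec_eq_iff forall_3 frameT_def Je)
  then show "\<exists>b c. w = ?a *\<^sub>R e + b *\<^sub>R J q e + c *\<^sub>R frameT"
    by blast
  fix a
  assume "\<exists>b c. w = a *\<^sub>R e + b *\<^sub>R J q e + c *\<^sub>R frameT"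
  then obtain b c where w: "w = a *\<^sub>R e + b *\<^sub>R J q e + c *\<^sub>R frameT"
    by blast
  have "w$1 = a * e$1 - b * e$2" "w$2 = a * e$2 + b * e$1"
    unfolding w by (simp_all add: Je frameT_def)
  then have "?a = a * ((e$1)\<^sup>2 + (e$2)\<^sup>2)"
    unfolding power2_eq_square by algebra
  then show "a = ?a"
    unfolding e by simp
qed

lemma subspace_contact_plane: "subspace (contact_plane q)"
  by (simp add: contact_plane_def)

lemma contact_plane_eq_span:
  assumes ind: "\<And>a b. a *\<^sub>R u + b *\<^sub>R v = 0 \<Longrightarrow> a = 0 \<and> b = 0"
    and "u \<in> contact_plane q" "v \<in> contact_plane q"
  shows "contact_plane q = span {u, v}"
proof -
  have "v \<noteq> 0"
    using ind[of 0 1] by auto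
  have "u \<notin> span {v}"
  proof
    assume "u \<in> span {v}"
    then obtain k where "u = k *\<^sub>R v"
      by (auto simp: span_singleton)
    then show False
      using ind[of 1 "-k"] by simp
  qed
  then have "independent {u, v}" "u \<noteq> v"
    using \<open>v \<noteq> 0\<close> by (auto simp: independent_insert span_base)
  then have "dim (span {u, v}) = 2"
    using dim_span_eq_card_independent[of "{u, v}"] by simp
  moreover have "dim (contact_plane q) \<le> 2"
  proof -
    have "dim (contact_plane q) \<le> card {frame1 q, frame2 q}"
      unfolding contact_plane_def by (intro dim_le_card) auto
    then show ?thesis
      using card_insert_le_m1[of 2 "{frame2 q}" "frame1 q"] by simp
  qed
  moreover have "span {u, v} \<subseteq> contact_plane q"
    using assms by (intro span_minimal subspace_contact_plane) auto
  ultimately show ?thesis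
    using subspace_dim_equal[of "span {u, v}" "contact_plane q"] subspace_contact_plane by simp
qed

text \<open>The vector \<open>w = \<Theta>(v) u - \<Theta>(u) v\<close> spans the intersection of the tangent plane with the
  contact plane at a regular point, so \<open>e\<close> is \<open>w\<close> divided by its length up to sign. The density is
  \<open>\<bar>\<langle>w, e\<rangle>\<bar>\<close>, that is the length of \<open>w\<close>, whose components are the two determinants up to sign. At
  singular points \<open>w\<close> is 0.\<close>
lemma p_area_density_eq:
  assumes ind: "\<And>a b. a *\<^sub>R u + b *\<^sub>R v = 0 \<Longrightarrow> a = 0 \<and> b = 0"
  shows "p_area_density q u v = sqrt ((wedge1 q u v)\<^sup>2 + (wedge2 q u v)\<^sup>2)"
proof -
  define tu tv where "tu = contact_form q u" and "tv = contact_form q v"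
  define w where "w = tv *\<^sub>R u - tu *\<^sub>R v"
  have w12: "w$1 = - wedge2 q u v" "w$2 = wedge1 q u v"
    by (simp_all add: w_def tu_def tv_def contact_form_def wedge1_def wedge2_def algebra_simps)
  have contact_w: "contact_form q w = 0"
    by (simp add: w_def tu_def tv_def contact_form_def algebra_simps)
  show ?thesis
  proof (cases "contact_plane q = span {u, v}")
    case True
    then have "tu = 0" "tv = 0"
      using span_base[of u "{u, v}"] span_base[of v "{u, v}"] contact_plane_eq[of q]
      by (auto simp: tu_def tv_def)
    then have "w = 0"
      by (simp add: w_def)
    then have "wedge1 q u v = 0" "wedge2 q u v = 0"
      using w12 by auto
    then show ?thesis
      using True by (simp add: p_area_density_def)
  next
    case False
    then have "tu \<noteq> 0 \<or> tv \<noteq> 0"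
      using contact_plane_eq_span[OF ind] by (auto simp: contact_plane_eq tu_def tv_def)
    then have "w \<noteq> 0"
      using ind[of tv "-tu"] by (auto simp: w_def)
    then have "\<not> (w$1 = 0 \<and> w$2 = 0)"
      using contact_w by (auto simp: vec_eq_iff forall_3 contact_form_def)
    then have pos: "levi_norm w > 0"
      by (simp add: levi_norm_def sum_power2_gt_zero_iff)
    let ?P = "\<lambda>e. e \<in> contact_plane q \<inter> span {u, v} \<and> levi_norm e = 1"
    define e where "e = (SOME e. ?P e)"
    have "levi_norm ((1 / levi_norm w) *\<^sub>R w) = 1"
    proof -
      have "levi_norm (k *\<^sub>R w) = \<bar>k\<bar> * levi_norm w" for k
        by (simp add: levi_norm_def power_mult_distrib distrib_left[symmetric] real_sqrt_mult)
      then show ?thesis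
        using pos by simp
    qed
    moreover have "w \<in> span {u, v}"
      unfolding w_def by (intro span_diff span_scale span_base) auto
    ultimately have "?P ((1 / levi_norm w) *\<^sub>R w)"
      using contact_w subspace_contact_plane
      by (simp add: contact_plane_eq subspace_scale span_scale contact_form_def)
        (simp add: add_divide_distrib[symmetric] diff_divide_distrib[symmetric])
    then have e: "?P e"
      unfolding e_def by (rule someI)
    then obtain \<alpha> \<beta> where ab: "e = \<alpha> *\<^sub>R u + \<beta> *\<^sub>R v"
      by (auto simp: span_insert algebra_simps)
    have "contact_form q e = 0"
      using e by (simp add: contact_plane_eq)
    then have tab: "\<alpha> * tu + \<beta> * tv = 0"
      unfolding ab tu_def tv_def contact_form_def by (simp add: algebra_simps)
    have "w$1 * e$2 - w$2 * e$1 = (\<alpha> * tu + \<beta> * tv) * (u$1 * v$2 - u$2 * v$1)"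
      unfolding w_def ab by (simp add: algebra_simps)
    then have par: "w$1 * e$2 - w$2 * e$1 = 0"
      by (simp add: tab)
    have unit: "(e$1)\<^sup>2 + (e$2)\<^sup>2 = 1"
      using e by (simp add: levi_norm_def)
    have "p_area_density q u v = \<bar>tu * coframe1 q e v - tv * coframe1 q e u\<bar>"
      using False by (simp add: p_area_density_def tu_def tv_def e_def Let_def)
    also have "\<dots> = \<bar>w$1 * e$1 + w$2 * e$2\<bar>"
      using e by (simp add: coframe1_eq w_def abs_minus_commute algebra_simps)
    also have "\<dots> = sqrt ((w$1 * e$1 + w$2 * e$2)\<^sup>2)"
      by simp
    also have "(w$1 * e$1 + w$2 * e$2)\<^sup>2 =
        ((w$1)\<^sup>2 + (w$2)\<^sup>2) * ((e$1)\<^sup>2 + (e$2)\<^sup>2) - (w$1 * e$2 - w$2 * e$1)\<^sup>2"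
      unfolding power2_eq_square by algebra
    finally show ?thesis
      unfolding unit par by (simp add: w12 add.commute)
  qed
qed


section \<open>Averaging over directions\<close>

text \<open>The shift is first reduced modulo the period \<open>\<pi>\<close> of the integrand to \<open>\<beta>\<close> in
  \<open>[-\<pi>/2, \<pi>/2)\<close>; then the cosine changes sign at \<open>\<pi>/2 - \<beta>\<close> and \<open>3\<pi>/2 - \<beta>\<close>.\<close>

lemma has_integral_abs_cos_shift: "((\<lambda>x. \<bar>cos (x + \<psi>)\<bar>) has_integral 4) {0..2 * pi}"
proof -
  define k where "k = \<lfloor>(\<psi> + pi / 2) / pi\<rfloor>"
  define \<beta> where "\<beta> = \<psi> - pi * k"
  have \<beta>: "- (pi / 2) \<le> \<beta>" "\<beta> < pi / 2"
  proof -
    have "k \<le> (\<psi> + pi / 2) / pi" "(\<psi> + pi / 2) / pi < k + 1"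
      unfolding k_def by linarith+
    then show "- (pi / 2) \<le> \<beta>" "\<beta> < pi / 2"
      by (simp_all add: \<beta>_def field_simps)
  qed
  have abs: "\<bar>cos (x + \<psi>)\<bar> = \<bar>cos (x + \<beta>)\<bar>" for x
  proof -
    have "cos (x + \<psi>) = cos ((x + \<beta>) + pi * k)"
      by (simp add: \<beta>_def)
    also have "\<dots> = cos (x + \<beta>) * cos (pi * k)"
      by (simp add: cos_add sin_int_times_real mult.commute)
    finally show ?thesis
      by (simp add: abs_mult)
  qed
  have FTC: "((\<lambda>x. \<bar>cos (x + \<beta>)\<bar>) has_integral \<epsilon> * sin (b + \<beta>) - \<epsilon> * sin (a + \<beta>)) {a..b}"
    if "a \<le> b" and sgn: "\<And>x. a \<le> x \<Longrightarrow> x \<le> b \<Longrightarrow> \<bar>cos (x + \<beta>)\<bar> = \<epsilon> * cos (x + \<beta>)" for a b \<epsilon>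
  proof (rule fundamental_theorem_of_calculus[OF \<open>a \<le> b\<close>])
    fix x
    assume "x \<in> {a..b}"
    then show "((\<lambda>x. \<epsilon> * sin (x + \<beta>)) has_vector_derivative \<bar>cos (x + \<beta>)\<bar>) (at x within {a..b})"
      using sgn by (auto intro!: derivative_eq_intros simp flip: has_real_derivative_iff_has_vector_derivative)
  qed
  have nonneg: "\<bar>cos (x + \<beta>)\<bar> = 1 * cos (x + \<beta>)" if "0 \<le> x" "x \<le> pi / 2 - \<beta>" for x
    using that \<beta> cos_ge_zero[of "x + \<beta>"] by simp
  have nonpos: "\<bar>cos (x + \<beta>)\<bar> = -1 * cos (x + \<beta>)" if "pi / 2 - \<beta> \<le> x" "x \<le> 3 * pi / 2 - \<beta>" for x
  proof -
    have "cos (x + \<beta> - pi) \<ge> 0"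
      using that by (intro cos_ge_zero) auto
    then show ?thesis
      by (simp add: cos_diff)
  qed
  have nonneg': "\<bar>cos (x + \<beta>)\<bar> = 1 * cos (x + \<beta>)" if "3 * pi / 2 - \<beta> \<le> x" "x \<le> 2 * pi" for x
  proof -
    have "cos (x + \<beta> - 2 * pi) \<ge> 0"
      using that \<beta> by (intro cos_ge_zero) auto
    then show ?thesis
      by (simp add: cos_diff)
  qed
  have "((\<lambda>x. \<bar>cos (x + \<beta>)\<bar>) has_integral
      (1 * sin (pi / 2 - \<beta> + \<beta>) - 1 * sin (0 + \<beta>)) +
      (-1 * sin (3 * pi / 2 - \<beta> + \<beta>) - -1 * sin (pi / 2 - \<beta> + \<beta>))) {0..3 * pi / 2 - \<beta>}"
    using \<beta> nonneg nonpos by (intro has_integral_combine[of 0 "pi / 2 - \<beta>"] FTC) auto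
  from has_integral_combine[OF _ _ this FTC[where \<epsilon> = 1 and b = "2 * pi"]]
  have "((\<lambda>x. \<bar>cos (x + \<beta>)\<bar>) has_integral
      (1 * sin (pi / 2 - \<beta> + \<beta>) - 1 * sin (0 + \<beta>)) +
      (-1 * sin (3 * pi / 2 - \<beta> + \<beta>) - -1 * sin (pi / 2 - \<beta> + \<beta>)) +
      (1 * sin (2 * pi + \<beta>) - 1 * sin (3 * pi / 2 - \<beta> + \<beta>))) {0..2 * pi}"
    using \<beta> nonneg' by simp
  moreover have "sin (3 * pi / 2) = (-1 :: real)"
    using sin_3over2_pi by simp
  ultimately show ?thesis
    by (simp add: abs sin_add)
qed

lemma nn_integral_abs_trig_combination:
  "(\<integral>\<^sup>+ \<phi> \<in> {0..<2 * pi}. ennreal \<bar>cos (\<phi> + \<theta>) * a + sin (\<phi> + \<theta>) * b\<bar> \<partial>lborel) =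
    ennreal (4 * sqrt (a\<^sup>2 + b\<^sup>2))"
proof -
  let ?r = "sqrt (a\<^sup>2 + b\<^sup>2)"
  obtain \<alpha> where \<alpha>: "a = ?r * cos \<alpha>" "b = ?r * sin \<alpha>"
    by (rule polar_coordinates)
  have eq: "\<bar>cos (\<phi> + \<theta>) * a + sin (\<phi> + \<theta>) * b\<bar> = ?r * \<bar>cos (\<phi> + (\<theta> - \<alpha>))\<bar>" for \<phi>
  proof -
    have "cos (\<phi> + \<theta>) * a + sin (\<phi> + \<theta>) * b = ?r * cos (\<phi> + \<theta> - \<alpha>)"
      unfolding cos_diff by (subst \<alpha>(1), subst \<alpha>(2)) (simp only: algebra_simps)
    then show ?thesis
      by (simp add: abs_mult add_diff_eq)
  qed
  have "((\<lambda>x. ?r * \<bar>cos (x + (\<theta> - \<alpha>))\<bar>) has_integral ?r * 4) {0..2 * pi}"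
    by (intro has_integral_mult_right has_integral_abs_cos_shift)
  then have "((\<lambda>x. ?r * \<bar>cos (x + (\<theta> - \<alpha>))\<bar>) has_integral ?r * 4) {0..<2 * pi}"
  proof (subst has_integral_spike_set_eq[where T = "{0..2 * pi}"])
    have "{0..2 * pi} - {0..<2 * pi} \<subseteq> {2 * pi}"
      by auto
    then show "negligible {x \<in> {0..2 * pi} - {0..<2 * pi}. ?r * \<bar>cos (x + (\<theta> - \<alpha>))\<bar> \<noteq> 0}"
      by (intro negligible_subset[OF negligible_sing[of "2 * pi"]]) auto
    show "negligible {x \<in> {0..<2 * pi} - {0..2 * pi}. ?r * \<bar>cos (x + (\<theta> - \<alpha>))\<bar> \<noteq> 0}"
      by (rule negligible_subset[OF negligible_empty]) auto
  qed
  from nn_integral_has_integral_lebesgue'[OF _ this] show ?thesis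
    unfolding eq by (simp add: mult.commute)
qed


section \<open>Chart decompositions\<close>

text \<open>Countably many chart images cover the surface by the Lindelof property; removing from each the
  earlier ones makes them disjoint.\<close>

lemma chart_decomposition_exists:
  assumes "smooth_surface S" "S \<noteq> {}"
  obtains X B where "chart_decomposition S X B"
proof -
  let ?F = "{X ` U | U X. surface_chart S U X}"
  have open_image: "openin (top_of_set S) (X ` U)" if "surface_chart S U X" for U X
    using that by (simp add: surface_chart_def)
  have "openin (top_of_set S) W" if "W \<in> ?F" for W
    using that open_image by blast
  then obtain F' where F': "F' \<subseteq> ?F" "countable F'" "\<Union>F' = \<Union>?F"
    by (rule Lindelof_openin)
  have "\<Union>?F = S"
  proof
    show "\<Union>?F \<subseteq> S"
      using surface_chartD(2) by blast
    show "S \<subseteq> \<Union>?F"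
    proof
      fix q
      assume "q \<in> S"
      then obtain U X where "surface_chart S U X" "q \<in> X ` U"
        using assms(1) unfolding smooth_surface_def by metis
      then show "q \<in> \<Union>?F"
        by (intro UnionI[of "X ` U"]) auto
    qed
  qed
  then have "F' \<noteq> {}" "\<Union>F' = S"
    using F'(3) assms(2) by (metis Union_empty, simp)
  define W where "W = from_nat_into F'"
  have range: "range W = F'"
    unfolding W_def using \<open>F' \<noteq> {}\<close> F'(2) by (rule range_from_nat_into)
  have "\<forall>n. \<exists>U X. surface_chart S U X \<and> W n = X ` U"
    using F'(1) range by blast
  then obtain U X where UX: "\<And>n. surface_chart S (U n) (X n)" "\<And>n. W n = X n ` U n"
    by metis
  define B where "B n = U n - (\<Union>m<n. U n \<inter> X n -` W m)" for n
  have image: "X n ` B n = disjointed W n" for n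
    unfolding B_def disjointed_def UX(2) by (auto simp: atLeast0LessThan)
  have "chart_decomposition S X B"
    unfolding chart_decomposition_def
  proof (intro conjI allI)
    show "B n \<in> sets borel" for n
    proof -
      have "open (U n \<inter> X n -` W m)" for m
      proof -
        have "openin (top_of_set (U n)) (U n \<inter> X n -` W m)"
          using surface_chartD[OF UX(1)[of n]] open_image[OF UX(1)[of m]]
          unfolding UX(2)[of m] by (intro continuous_openin_preimage[of _ _ S]) auto
        then show ?thesis
          using surface_chartD(1)[OF UX(1)[of n]] by (simp add: openin_open_eq)
      qed
      moreover have "open (U n)"
        using surface_chartD(1)[OF UX(1)] .
      ultimately show ?thesis
        unfolding B_def by (intro sets.Diff sets.finite_UN borel_open) auto
    qed
    show "\<exists>V. surface_chart S V (X n) \<and> B n \<subseteq> V" for n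
      using UX(1)[of n] by (auto simp: B_def)
    show "disjoint_family (\<lambda>i. X i ` B i)"
      unfolding image by (rule disjoint_family_disjointed)
    show "(\<Union>i. X i ` B i) = S"
      unfolding image UN_disjointed_eq using range \<open>\<Union>F' = S\<close> by simp
  qed
  then show thesis
    by (rule that)
qed


section \<open>p-Area and kinematic measure\<close>

abbreviation chart_density :: "(real^2 \<Rightarrow> real^3) \<Rightarrow> real^2 \<Rightarrow> real" where
  "chart_density X u \<equiv> p_area_density (X u)
     (frechet_derivative X (at u) (axis 1 1)) (frechet_derivative X (at u) (axis 2 1))"

lemma emeasure_shadow_measurable:
  assumes "open D"
  shows "(\<lambda>\<theta>. emeasure lborel (shadow \<theta> ` D)) \<in> borel_measurable borel"
proof -
  let ?G = "\<Union>\<sigma>. (\<lambda>x. line_point (fst x) \<sigma> (snd x)) -` D"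
  have "open ?G"
    by (intro open_UN ballI open_vimage assms continuous_intros)
  then have "?G \<in> sets (lborel \<Otimes>\<^sub>M lborel)"
    unfolding lborel_prod by simp
  then have "(\<lambda>\<theta>. emeasure lborel (Pair \<theta> -` ?G)) \<in> borel_measurable lborel"
    by (rule lborel.measurable_emeasure_Pair)
  moreover have "Pair \<theta> -` ?G = shadow \<theta> ` D" for \<theta>
    by (simp add: set_eq_iff mem_shadow_iff)
  ultimately show ?thesis
    by simp
qed

text \<open>By Tonelli the average over the angle is taken at each point of the chart, where the Jacobian is
  a trigonometric function of the angle.\<close>
lemma nn_integral_chart_density:
  assumes "surface_chart S U X" "B \<in> sets borel" "B \<subseteq> U"
  shows "(\<integral>\<^sup>+ \<phi> \<in> {0..<2 * pi}. (\<integral>\<^sup>+ u \<in> B. ennreal \<bar>chart_jacobian (\<phi> + \<theta>) X u\<bar> \<partial>lborel) \<partial>lborel) =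
      4 * (\<integral>\<^sup>+ u \<in> B. ennreal (chart_density X u) \<partial>lborel)"
    and "(\<lambda>\<phi>. \<integral>\<^sup>+ u \<in> B. ennreal \<bar>chart_jacobian (\<phi> + \<theta>) X u\<bar> \<partial>lborel) \<in> borel_measurable borel"
proof -
  let ?w1 = "\<lambda>u. wedge1 (X u) (frechet_derivative X (at u) (axis 1 1)) (frechet_derivative X (at u) (axis 2 1))"
  let ?w2 = "\<lambda>u. wedge2 (X u) (frechet_derivative X (at u) (axis 1 1)) (frechet_derivative X (at u) (axis 2 1))"
  define a where "a u = indicator B u * ?w1 u" for u
  define b where "b u = indicator B u * ?w2 u" for u
  have [measurable]: "a \<in> borel_measurable borel" "b \<in> borel_measurable borel"
    unfolding a_def[abs_def] b_def[abs_def] using wedge_measurable[OF assms] by simp_all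
  define f where "f \<phi> u = ennreal \<bar>cos (\<phi> + \<theta>) * a u + sin (\<phi> + \<theta>) * b u\<bar>" for \<phi> u
  have f: "ennreal \<bar>chart_jacobian (\<phi> + \<theta>) X u\<bar> * indicator B u = f \<phi> u" for \<phi> u
    by (simp add: f_def a_def b_def shadow_jacobian_def indicator_def)
  have density: "ennreal (chart_density X u) * indicator B u = ennreal (sqrt ((a u)\<^sup>2 + (b u)\<^sup>2))" for u
  proof (cases "u \<in> B")
    case True
    then have "u \<in> U"
      using assms(3) by blast
    let ?X' = "frechet_derivative X (at u)"
    have lin: "linear ?X'"
      using surface_chartD(5)[OF assms(1) \<open>u \<in> U\<close>] by (rule has_derivative_linear)
    have "inj ?X'"
      using assms(1) \<open>u \<in> U\<close> by (simp add: surface_chart_def)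
    have "\<alpha> = 0 \<and> \<beta> = 0" if "\<alpha> *\<^sub>R ?X' (axis 1 1) + \<beta> *\<^sub>R ?X' (axis 2 1) = 0" for \<alpha> \<beta>
    proof -
      have "?X' (\<alpha> *\<^sub>R axis 1 1 + \<beta> *\<^sub>R axis 2 1) = ?X' 0"
        using that by (simp add: linear_add[OF lin] linear_cmul[OF lin] linear_0[OF lin])
      then have "\<alpha> *\<^sub>R axis 1 1 + \<beta> *\<^sub>R axis 2 1 = (0 :: real^2)"
        using \<open>inj ?X'\<close> by (simp only: inj_eq)
      then show ?thesis
        by (simp add: vec_eq_iff forall_2 axis_def)
    qed
    from p_area_density_eq[OF this] have "chart_density X u = sqrt ((a u)\<^sup>2 + (b u)\<^sup>2)"
      using True by (simp add: a_def b_def)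
    then show ?thesis
      using True by simp
  qed (simp add: a_def b_def)
  have f_meas: "(\<lambda>(\<phi>, u). f \<phi> u) \<in> borel_measurable (lborel \<Otimes>\<^sub>M lborel)"
    unfolding f_def by measurable
  then show "(\<lambda>\<phi>. \<integral>\<^sup>+ u \<in> B. ennreal \<bar>chart_jacobian (\<phi> + \<theta>) X u\<bar> \<partial>lborel) \<in> borel_measurable borel"
    unfolding f using lborel.borel_measurable_nn_integral[OF f_meas] by simp
  have "(\<integral>\<^sup>+ \<phi> \<in> {0..<2 * pi}. (\<integral>\<^sup>+ u. f \<phi> u \<partial>lborel) \<partial>lborel) =
      (\<integral>\<^sup>+ \<phi>. (\<integral>\<^sup>+ u. f \<phi> u * indicator {0..<2 * pi} \<phi> \<partial>lborel) \<partial>lborel)"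
    by (intro nn_integral_cong nn_integral_multc[symmetric]) (simp add: f_def)
  also have "\<dots> = (\<integral>\<^sup>+ u. (\<integral>\<^sup>+ \<phi> \<in> {0..<2 * pi}. f \<phi> u \<partial>lborel) \<partial>lborel)"
  proof (rule lborel_pair.Fubini'[symmetric])
    show "(\<lambda>(\<phi>, u). f \<phi> u * indicator {0..<2 * pi} \<phi>) \<in> borel_measurable (lborel \<Otimes>\<^sub>M lborel)"
      unfolding f_def by measurable
  qed
  also have "\<dots> = (\<integral>\<^sup>+ u. ennreal (4 * sqrt ((a u)\<^sup>2 + (b u)\<^sup>2)) \<partial>lborel)"
    unfolding f_def nn_integral_abs_trig_combination ..
  also have "\<dots> = (\<integral>\<^sup>+ u. 4 * (ennreal (chart_density X u) * indicator B u) \<partial>lborel)"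
    unfolding density by (simp add: ennreal_mult)
  also have "\<dots> = 4 * (\<integral>\<^sup>+ u \<in> B. ennreal (chart_density X u) \<partial>lborel)"
    by (rule nn_integral_cmult) (simp add: density)
  finally show "(\<integral>\<^sup>+ \<phi> \<in> {0..<2 * pi}. (\<integral>\<^sup>+ u \<in> B. ennreal \<bar>chart_jacobian (\<phi> + \<theta>) X u\<bar> \<partial>lborel) \<partial>lborel) =
      4 * (\<integral>\<^sup>+ u \<in> B. ennreal (chart_density X u) \<partial>lborel)"
    unfolding f .
qed


text \<open>A Cauchy-Crofton formula: the left side does not involve the decomposition.\<close>
lemma nn_integral_shadow_area:
  assumes D: "open D" "bounded D" "convex D" "D \<noteq> {}"
    and dec: "chart_decomposition (frontier D) X B"
  shows "(\<integral>\<^sup>+ \<phi> \<in> {0..<2 * pi}. emeasure lborel (shadow (\<phi> + \<theta>) ` D) \<partial>lborel) =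
    2 * (\<Sum>i. \<integral>\<^sup>+ u \<in> B i. ennreal (chart_density (X i) u) \<partial>lborel)"
proof -
  have "\<exists>U. surface_chart (frontier D) U (X i) \<and> B i \<subseteq> U \<and> B i \<in> sets borel" for i
    using dec unfolding chart_decomposition_def by blast
  then obtain U where U: "\<And>i. surface_chart (frontier D) (U i) (X i)" "\<And>i. B i \<in> sets borel"
    "\<And>i. B i \<subseteq> U i"
    by metis
  let ?g = "\<lambda>i \<phi>. \<integral>\<^sup>+ u \<in> B i. ennreal \<bar>chart_jacobian (\<phi> + \<theta>) (X i) u\<bar> \<partial>lborel"
  have meas: "(\<lambda>\<phi>. emeasure lborel (shadow (\<phi> + \<theta>) ` D)) \<in> borel_measurable borel"
    using measurable_compose[OF _ emeasure_shadow_measurable[OF D(1)], of "\<lambda>\<phi>. \<phi> + \<theta>" borel] by simp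
  have "2 * (\<integral>\<^sup>+ \<phi> \<in> {0..<2 * pi}. emeasure lborel (shadow (\<phi> + \<theta>) ` D) \<partial>lborel) =
      (\<integral>\<^sup>+ \<phi>. 2 * (emeasure lborel (shadow (\<phi> + \<theta>) ` D) * indicator {0..<2 * pi} \<phi>) \<partial>lborel)"
    using meas by (intro nn_integral_cmult[symmetric]) simp
  also have "\<dots> = (\<integral>\<^sup>+ \<phi>. (\<Sum>i. ?g i \<phi> * indicator {0..<2 * pi} \<phi>) \<partial>lborel)"
    unfolding ennreal_suminf_multc nn_integral_chart_jacobian[OF D dec] mult.assoc ..
  also have "\<dots> = (\<Sum>i. \<integral>\<^sup>+ \<phi>. ?g i \<phi> * indicator {0..<2 * pi} \<phi> \<partial>lborel)"
    using nn_integral_chart_density(2)[OF U] by (intro nn_integral_suminf) simp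
  also have "\<dots> = (\<Sum>i. 4 * (\<integral>\<^sup>+ u \<in> B i. ennreal (chart_density (X i) u) \<partial>lborel))"
    unfolding nn_integral_chart_density(1)[OF U] ..
  also have "\<dots> = 4 * (\<Sum>i. \<integral>\<^sup>+ u \<in> B i. ennreal (chart_density (X i) u) \<partial>lborel)"
    by (rule ennreal_suminf_cmult)
  also have "\<dots> = 2 * (2 * (\<Sum>i. \<integral>\<^sup>+ u \<in> B i. ennreal (chart_density (X i) u) \<partial>lborel))"
    by (simp add: mult.assoc[symmetric])
  finally show ?thesis
    by (subst (asm) ennreal_mult_cancel_left) auto
qed

text \<open>The shadows of a bounded set in all directions lie in one disc. Finiteness is needed because the
  p-area is a real number, obtained from an extended one by sending infinity to 0.\<close>
lemma nn_integral_shadow_area_finite: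
  assumes "bounded D"
  shows "(\<integral>\<^sup>+ \<phi> \<in> {0..<2 * pi}. emeasure lborel (shadow (\<phi> + \<theta>) ` D) \<partial>lborel) < \<infinity>"
proof -
  obtain b where b: "0 < b" "\<And>P. P \<in> D \<Longrightarrow> norm P \<le> b"
    using assms bounded_pos by blast
  let ?R = "2 * b + (b + 2 * b * (2 * b))"
  have "norm (shadow \<theta> P) \<le> ?R" if "P \<in> D" for \<theta> P
  proof -
    have P: "\<bar>P$i\<bar> \<le> b" for i
      using component_le_norm_cart[of P i] b(2)[OF that] by linarith
    have combination: "\<bar>x * c\<bar> + \<bar>y * d\<bar> \<le> 2 * b" if "\<bar>x\<bar> \<le> b" "\<bar>y\<bar> \<le> b" "\<bar>c\<bar> \<le> 1" "\<bar>d\<bar> \<le> 1" for x y c d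
      using mult_mono[of "\<bar>x\<bar>" b "\<bar>c\<bar>" 1] mult_mono[of "\<bar>y\<bar>" b "\<bar>d\<bar>" 1] that b(1)
      by (simp add: abs_mult)
    let ?\<sigma> = "P$1 * cos \<theta> + P$2 * sin \<theta>" and ?\<eta> = "P$2 * cos \<theta> - P$1 * sin \<theta>"
    have \<sigma>: "\<bar>?\<sigma>\<bar> \<le> 2 * b"
      using combination[of "P$1" "P$2" "cos \<theta>" "sin \<theta>"] P abs_triangle_ineq[of "P$1 * cos \<theta>" "P$2 * sin \<theta>"]
      by simp
    have \<eta>: "\<bar>?\<eta>\<bar> \<le> 2 * b"
      using combination[of "P$2" "P$1" "cos \<theta>" "sin \<theta>"] P abs_triangle_ineq4[of "P$2 * cos \<theta>" "P$1 * sin \<theta>"]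
      by simp
    have "\<bar>?\<sigma> * ?\<eta>\<bar> \<le> 2 * b * (2 * b)"
      unfolding abs_mult using \<sigma> \<eta> b(1) by (intro mult_mono) auto
    then have "\<bar>P$3 - ?\<sigma> * ?\<eta>\<bar> \<le> b + 2 * b * (2 * b)"
      using P[of 3] abs_triangle_ineq4[of "P$3" "?\<sigma> * ?\<eta>"] by linarith
    moreover have "norm (shadow \<theta> P) \<le> \<bar>?\<eta>\<bar> + \<bar>P$3 - ?\<sigma> * ?\<eta>\<bar>"
      using norm_le_l1_cart[of "shadow \<theta> P"] by (simp add: sum_2 shadow_def)
    ultimately show ?thesis
      using \<eta> by linarith
  qed
  then have "shadow \<theta> ` D \<subseteq> cball 0 ?R" for \<theta>
    by auto
  then have "emeasure lborel (shadow \<theta> ` D) \<le> emeasure lborel (cball (0 :: real^2) ?R)" for \<theta>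
    by (intro emeasure_mono) simp_all
  then have "(\<integral>\<^sup>+ \<phi> \<in> {0..<2 * pi}. emeasure lborel (shadow (\<phi> + \<theta>) ` D) \<partial>lborel) \<le>
      (\<integral>\<^sup>+ \<phi> \<in> {0..<2 * pi}. emeasure lborel (cball (0 :: real^2) ?R) \<partial>lborel)"
    by (intro nn_integral_mono mult_right_mono) simp_all
  also have "\<dots> = emeasure lborel (cball (0 :: real^2) ?R) * ennreal (2 * pi)"
    by (subst nn_integral_cmult_indicator) simp_all
  also have "\<dots> < \<infinity>"
    using emeasure_bounded_finite[of "cball (0 :: real^2) ?R"] by (simp add: ennreal_mult_less_top)
  finally show ?thesis .
qed

lemma p_area_eq_shadow_area:
  assumes D: "open D" "bounded D" "convex D" "D \<noteq> {}" and smooth: "smooth_surface (frontier D)"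
  shows "(\<integral>\<^sup>+ \<phi> \<in> {0..<2 * pi}. emeasure lborel (shadow (\<phi> + \<theta>) ` D) \<partial>lborel) =
    ennreal (2 * p_area (frontier D))"
proof -
  let ?area = "\<lambda>X B. \<Sum>i. \<integral>\<^sup>+ u \<in> B i. ennreal (chart_density (X i) u) \<partial>lborel"
  have "D \<noteq> UNIV"
    using D(2) not_bounded_UNIV by blast
  then have "frontier D \<noteq> {}"
    using D(4) by (simp add: frontier_eq_empty)
  then obtain X B where XB: "chart_decomposition (frontier D) X B"
    using chart_decomposition_exists[OF smooth] by blast
  note shadow_area = nn_integral_shadow_area[OF D]
  have "(THE A. \<exists>X B. chart_decomposition (frontier D) X B \<and> A = ?area X B) = ?area X B"
  proof (rule the_equality)
    fix A
    assume "\<exists>X B. chart_decomposition (frontier D) X B \<and> A = ?area X B"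
    then obtain X' B' where "chart_decomposition (frontier D) X' B'" "A = ?area X' B'"
      by blast
    then have "2 * A = 2 * ?area X B"
      using shadow_area[OF XB, of \<theta>] shadow_area[of X' B' \<theta>] by simp
    then show "A = ?area X B"
      by (subst (asm) ennreal_mult_cancel_left) auto
  qed (use XB in blast)
  then have p_area: "p_area (frontier D) = enn2real (?area X B)"
    by (simp add: p_area_def)
  have "2 * ?area X B < \<infinity>"
    using nn_integral_shadow_area_finite[OF D(2), of \<theta>] shadow_area[OF XB, of \<theta>] by simp
  then have "?area X B < top"
    by (auto simp: ennreal_mult_less_top)
  then have "ennreal (2 * p_area (frontier D)) = 2 * ?area X B"
    unfolding p_area by (simp add: ennreal_mult)
  then show ?thesis
    using shadow_area[OF XB, of \<theta>] by simp
qed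

lemma p_area_nonneg: "0 \<le> p_area S"
  by (simp add: p_area_def)

text \<open>Integrating the volume for a fixed angle over all angles; the angle between \<open>e\<^sub>1\<close> and the
  unmoved segment only shifts the angle of integration.\<close>
lemma kinematic_measure_segment:
  assumes D: "open D" "bounded D" "convex D" "D \<noteq> {}" and smooth: "smooth_surface (frontier D)"
    and seg: "0 \<le> l" "q = p + l *\<^sub>R horizontal_direction \<theta> p"
  shows "kinematic_measure {F \<in> PSH1. F ` path_image (linepath p q) \<inter> D \<noteq> {}} =
    2 * pi * measure lebesgue D + 2 * l * p_area (frontier D)"
proof -
  let ?seg = "path_image (linepath p q)" and ?I = "{0..<2 * pi}"
  define K where "K = {(Q, \<phi>). 0 \<le> \<phi> \<and> \<phi> < 2 * pi \<and> motion Q \<phi> ` ?seg \<inter> D \<noteq> {}}"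
  have "D \<in> lmeasurable"
    using D(1,2) by (simp add: lmeasurable_open)
  then have vol: "emeasure lborel D = ennreal (measure lebesgue D)"
    using emeasure_eq_measure2[of D lebesgue] D(1) by simp
  have K_eq: "K = (\<Union>x\<in>?seg. (\<lambda>z. motion (fst z) (snd z) x) -` D) \<inter> (UNIV \<times> ?I)"
    unfolding K_def by force
  have "open (\<Union>x\<in>?seg. (\<lambda>z. motion (fst z) (snd z) x) -` D)"
    unfolding motion_def motion_linear_def by (intro open_UN ballI open_vimage D(1) continuous_intros)
  then have "K \<in> sets borel"
    unfolding K_eq by (intro sets.Int[OF borel_open borel_Times]) simp_all
  then have K: "K \<in> sets (lborel \<Otimes>\<^sub>M lborel)"
    unfolding lborel_prod by simp
  have slice: "emeasure lborel ((\<lambda>Q. (Q, \<phi>)) -` K) =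
      emeasure lborel D * indicator ?I \<phi> +
      ennreal l * (emeasure lborel (shadow (\<phi> + \<theta>) ` D) * indicator ?I \<phi>)" for \<phi>
  proof (cases "\<phi> \<in> ?I")
    case True
    then have "(\<lambda>Q. (Q, \<phi>)) -` K = {Q. motion Q \<phi> ` ?seg \<inter> D \<noteq> {}}"
      by (auto simp: K_def)
    then show ?thesis
      using True emeasure_motions_fixed_angle[OF D(1-3) seg, of \<phi>] by simp
  next
    case False
    then have "(\<lambda>Q. (Q, \<phi>)) -` K = {}"
      by (auto simp: K_def)
    then show ?thesis
      using False by simp
  qed
  have meas: "(\<lambda>\<phi>. emeasure lborel (shadow (\<phi> + \<theta>) ` D) * indicator ?I \<phi>) \<in> borel_measurable lborel"
    using measurable_compose[OF _ emeasure_shadow_measurable[OF D(1)], of "\<lambda>\<phi>. \<phi> + \<theta>" borel] by simp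
  have "emeasure lborel K = (\<integral>\<^sup>+ \<phi>. emeasure lborel ((\<lambda>Q. (Q, \<phi>)) -` K) \<partial>lborel)"
    using lborel_pair.emeasure_pair_measure_alt2[OF K] by (simp add: lborel_prod)
  also have "\<dots> = (\<integral>\<^sup>+ \<phi> \<in> ?I. emeasure lborel D \<partial>lborel) +
      ennreal l * (\<integral>\<^sup>+ \<phi> \<in> ?I. emeasure lborel (shadow (\<phi> + \<theta>) ` D) \<partial>lborel)"
    unfolding slice using meas by (simp add: nn_integral_add nn_integral_cmult)
  also have "\<dots> = emeasure lborel D * ennreal (2 * pi) + ennreal l * ennreal (2 * p_area (frontier D))"
    unfolding p_area_eq_shadow_area[OF D smooth] by (subst nn_integral_cmult_indicator) simp_all
  also have "\<dots> = ennreal (2 * pi * measure lebesgue D + 2 * l * p_area (frontier D))"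
    using seg(1) p_area_nonneg[of "frontier D"]
    by (simp add: vol ennreal_mult'[symmetric] ennreal_plus[symmetric] ac_simps del: ennreal_plus)
  finally have "emeasure lborel K =
      ennreal (2 * pi * measure lebesgue D + 2 * l * p_area (frontier D))" .
  then have "measure lborel K = 2 * pi * measure lebesgue D + 2 * l * p_area (frontier D)"
    using seg(1) p_area_nonneg[of "frontier D"] by (intro measure_eq_emeasure_eq_ennreal) simp_all
  then show ?thesis
    unfolding kinematic_measure_def motion_coordinates_image K_def .
qed

theorem corollary1p7:
  fixes D1 D2 :: "(real^3) set" and p q :: "real^3" and l :: real
  assumes "open D1" "D1 \<noteq> {}" "bounded D1" "convex D1" "smooth_surface (frontier D1)"
    and "open D2" "D2 \<noteq> {}" "bounded D2" "convex D2" "smooth_surface (frontier D2)"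
    and "D1 \<subseteq> D2"
    and "horizontal (linepath p q)" and "levi_length (linepath p q) = l"
  shows "kinematic_measure {F \<in> PSH1. F ` path_image (linepath p q) \<inter> D1 \<noteq> {}} /
         kinematic_measure {F \<in> PSH1. F ` path_image (linepath p q) \<inter> D2 \<noteq> {}} =
         (2 * pi * measure lebesgue D1 + 2 * l * p_area (frontier D1)) /
         (2 * pi * measure lebesgue D2 + 2 * l * p_area (frontier D2))"
proof -
  obtain \<theta> where seg: "0 \<le> l" "q = p + l *\<^sub>R horizontal_direction \<theta> p"
    using horizontal_segment_direction[OF assms(12,13)] .
  show ?thesis
    using kinematic_measure_segment[OF assms(1,3,4,2,5) seg]
      kinematic_measure_segment[OF assms(6,8,9,7,10) seg] by (simp only:)
qed

end
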